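(* Let $D$ be one of $\mathbb{R}^d$, $\mathbb{R}^m\times\mathbb{R}^n$, $\mathbb{T}^d$, $\mathbb{T}^m\times\mathbb{T}^n$, let $N\ge1$, and let $W=(w_{ij})\colon D\to\mathbb{C}^{N\times N}$ be a matrix weight which is invertible a.e. (that is, $W$ is measurable and positive definite a.e.). Fix $1<p<\infty$ and denote the entries of powers of $W$ by $W^{s}=(w_{ij}^{(s)})$, where $s$ is any real number. Suppose that $$w_{kk}^{(2/p)}\,w_{kk}^{(-2/p)}\in L^\infty(D),\qquad k=1,2,\dots,N,$$ and that the scalar weight $\big(w_{kk}^{(2/p)}\big)^{p/2}$ belongs to $A_p(1,D,\mathcal{S}_D)$ for $k=1,2,\dots,N$. Then $W\in A_p(N,D,\mathcal{S}_D)$.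
   Context: $\mathbb{T}^d$ is the $d$-dimensional torus. $\mathcal{S}_D$ is the following family of subsets of $D$: if $D\in\{\mathbb{R}^d,\mathbb{T}^d\}$, it is the collection of all Euclidean balls in $D$; if $D=\mathbb{R}^m\times\mathbb{R}^n$ [resp. $\mathbb{T}^m\times\mathbb{T}^n$], it is the collection of all products $B\times B'$ with $B$ a ball in $\mathbb{R}^m$ [resp. $\mathbb{T}^m$] and $B'$ a ball in $\mathbb{R}^n$ [resp. $\mathbb{T}^n$] (radii arbitrary and independent). Powers $W^s$ are defined pointwise by the functional calculus for positive definite matrices, so $w_{kk}^{(s)}$ is the $k$-th diagonal entry of $W^s$. Matrix $A_p$ class: let $1<p<\infty$, $1/p+1/q=1$, and let $W\colon D\to\mathbb{C}^{N\times N}$ be measurable and positive definite a.e. For $t\in D$, $x\in\mathbb{C}^N$ put $\rho_t(x)=\|W^{1/p}(t)x\|$ and $\rho_t^*(x)=\sup_{y\neq0}\frac{|\langle x,y\rangle|}{\rho_t(y)}=\|W^{-1/p}(t)x\|$. For $E\in\mathcal{S}_D$ put $$\rho_{p,E}(x)=\Big(\frac1{|E|}\int_E\rho_t(x)^p\,dt\Big)^{1/p},\qquad \rho^*_{q,E}(x)=\Big(\frac1{|E|}\int_E\rho_t^*(x)^q\,dt\Big)^{1/q},$$ and $(\rho_{p,E})^*(x)=\sup_{y\ne0}\frac{|\langle x,y\rangle|}{\rho_{p,E}(y)}$. Then $W\in A_p(N,D,\mathcal{S}_D)$ means that $W$ and $W^{-q/p}$ are locally integrable and there is $C<\infty$ such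 that $\rho^*_{q,E}(x)\le C(\rho_{p,E})^*(x)$ for all $x\in\mathbb{C}^N$ and all $E\in\mathcal{S}_D$. For $N=1$ this is the usual class of scalar Muckenhoupt weights with respect to $\mathcal{S}_D$. *)

theory Defs
  imports "HOL-Analysis.Analysis"
begin

subsection \<open>Positive definite matrices and their real powers\<close>

text \<open>The library's \<open>inner\<close> on \<open>complex ^ 'n\<close> is only the real part of the
  Hermitian inner product; the library's \<open>norm\<close> is the norm induced by either.\<close>

definition cinner :: "complex ^ 'n \<Rightarrow> complex ^ 'n \<Rightarrow> complex" where
  "cinner x y = (\<Sum>i\<in>UNIV. x $ i * cnj (y $ i))"

definition ctranspose :: "complex ^ 'n ^ 'm \<Rightarrow> complex ^ 'm ^ 'n" where
  "ctranspose A = (\<chi> i j. cnj (A $ j $ i))"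

definition unitary :: "complex ^ 'n ^ 'n \<Rightarrow> bool" where
  "unitary U \<longleftrightarrow> ctranspose U ** U = mat 1 \<and> U ** ctranspose U = mat 1"

definition posdef :: "complex ^ 'n ^ 'n \<Rightarrow> bool" where
  "posdef A \<longleftrightarrow> ctranspose A = A \<and> (\<forall>x. x \<noteq> 0 \<longrightarrow> 0 < Re (cinner (A *v x) x))"

definition real_diag :: "('n \<Rightarrow> real) \<Rightarrow> complex ^ 'n ^ 'n" where
  "real_diag l = (\<chi> i j. if i = j then complex_of_real (l i) else 0)"

text \<open>Functional calculus: diagonalise unitarily and raise the eigenvalues to the power \<open>s\<close>.
  The result does not depend on the diagonalisation (\<open>mat_powr_eqI\<close> below); it is unspecified
  if \<open>A\<close> is not Hermitian.\<close>

definition mat_powr :: "complex ^ 'n ^ 'n \<Rightarrow> real \<Rightarrow> complex ^ 'n ^ 'n" where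
  "mat_powr A s = (THE B. \<exists>U l. unitary U \<and> A = U ** real_diag l ** ctranspose U \<and>
                     B = U ** real_diag (\<lambda>i. l i powr s) ** ctranspose U)"

lemma real_diag_mult_left: "(real_diag l ** M) $ i $ j = complex_of_real (l i) * M $ i $ j"
proof -
  have "(real_diag l ** M) $ i $ j =
      (\<Sum>k\<in>UNIV. if k = i then complex_of_real (l i) * M $ k $ j else 0)"
    unfolding matrix_matrix_mult_def real_diag_def by (simp only: vec_lambda_beta, intro sum.cong) auto
  then show ?thesis by simp
qed

lemma real_diag_mult_right: "(M ** real_diag l) $ i $ j = M $ i $ j * complex_of_real (l j)"
proof -
  have "(M ** real_diag l) $ i $ j =
      (\<Sum>k\<in>UNIV. if k = j then M $ i $ k * complex_of_real (l j) else 0)"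
    unfolding matrix_matrix_mult_def real_diag_def by (simp only: vec_lambda_beta, intro sum.cong) auto
  then show ?thesis by simp
qed

lemma mat_powr_eqI:
  assumes U: "unitary U" and A: "A = U ** real_diag l ** ctranspose U"
  shows "mat_powr A s = U ** real_diag (\<lambda>i. l i powr s) ** ctranspose U"
proof -
  have uniq: "V ** real_diag (\<lambda>i. m i powr s) ** ctranspose V =
      U ** real_diag (\<lambda>i. l i powr s) ** ctranspose U"
    if V: "unitary V" and A': "A = V ** real_diag m ** ctranspose V" for V m
  proof -
    define M where "M = ctranspose V ** U"
    have "real_diag m ** M = ctranspose V ** A ** U"
      using V unfolding A' M_def unitary_def by (simp add: matrix_mul_assoc)
    also have "\<dots> = M ** real_diag l"
      using U unfolding A M_def unitary_def by (simp flip: matrix_mul_assoc)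
    finally have eq: "real_diag m ** M = M ** real_diag l" .
    have ent: "complex_of_real (m i) * M $ i $ j = M $ i $ j * complex_of_real (l j)" for i j
      using arg_cong[OF eq, of "\<lambda>B. B $ i $ j"]
      by (simp add: real_diag_mult_left real_diag_mult_right)
    have "m i = l j \<or> M $ i $ j = 0" for i j
      using ent[of i j] by auto
    then have "complex_of_real (m i powr s) * M $ i $ j
        = M $ i $ j * complex_of_real (l j powr s)" for i j
      by (metis mult.commute mult_zero_left)
    then have eq2: "real_diag (\<lambda>i. m i powr s) ** M = M ** real_diag (\<lambda>i. l i powr s)"
      by (simp add: vec_eq_iff real_diag_mult_left real_diag_mult_right)
    have "V ** real_diag (\<lambda>i. m i powr s) ** ctranspose V =
        V ** (real_diag (\<lambda>i. m i powr s) ** M) ** ctranspose U"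
      using U unfolding M_def unitary_def by (simp flip: matrix_mul_assoc)
    also have "\<dots> = U ** real_diag (\<lambda>i. l i powr s) ** ctranspose U"
      using V unfolding eq2 unfolding M_def unitary_def by (simp add: matrix_mul_assoc)
    finally show ?thesis .
  qed
  show ?thesis
    unfolding mat_powr_def using U A uniq by (intro the_equality) blast+
qed

subsection \<open>The domains and their families of sets\<close>

text \<open>The torus of dimension \<open>CARD('d)\<close> is represented by the fundamental domain \<open>[0,1)\<^sup>d\<close>
  of the quotient by the integer lattice, with Lebesgue measure and the quotient distance.\<close>

definition torus :: "(real ^ 'd) set" where
  "torus = {x. \<forall>i. 0 \<le> x $ i \<and> x $ i < 1}"

definition torus_dist :: "real ^ 'd \<Rightarrow> real ^ 'd \<Rightarrow> real" where
  "torus_dist x y = (INF z\<in>{z. \<forall>i. z $ i - y $ i \<in> \<int>}. dist x z)"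

definition euclidean_balls :: "(real ^ 'd) set set" where
  "euclidean_balls = {ball x r |x r. 0 < r}"

definition torus_balls :: "(real ^ 'd) set set" where
  "torus_balls = {{y \<in> torus. torus_dist x y < r} |x r. x \<in> torus \<and> 0 < r}"

definition product_sets :: "'a set set \<Rightarrow> 'b set set \<Rightarrow> ('a \<times> 'b) set set" where
  "product_sets S T = {B \<times> B' |B B'. B \<in> S \<and> B' \<in> T}"

subsection \<open>Matrix weights and the matrix \<open>A\<^sub>p\<close> class\<close>

definition matrix_weight :: "'a::euclidean_space set \<Rightarrow> ('a \<Rightarrow> complex ^ 'n ^ 'n) \<Rightarrow> bool" where
  "matrix_weight D W \<longleftrightarrow>
     W \<in> borel_measurable (lebesgue_on D) \<and> (AE t in lebesgue_on D. posdef (W t))"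

text \<open>The compact sets \<open>K\<close> range over the ambient space, not over \<open>D\<close>: for a torus this yields
  integrability over the whole fundamental domain, as it should, the torus being compact.\<close>

definition locally_integrable ::
    "'a::euclidean_space set \<Rightarrow> ('a \<Rightarrow> 'b::euclidean_space) \<Rightarrow> bool" where
  "locally_integrable D f \<longleftrightarrow> (\<forall>K. compact K \<longrightarrow> set_integrable lebesgue (D \<inter> K) f)"

definition Linfty :: "'a::euclidean_space set \<Rightarrow> ('a \<Rightarrow> complex) set" where
  "Linfty D = {f \<in> borel_measurable (lebesgue_on D).
                 \<exists>C. AE t in lebesgue_on D. norm (f t) \<le> C}"

definition dual_norm :: "(complex ^ 'n \<Rightarrow> real) \<Rightarrow> complex ^ 'n \<Rightarrow> real" where
  "dual_norm \<nu> x = (SUP y\<in>{y. y \<noteq> 0}. cmod (cinner x y) / \<nu> y)"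

definition rho :: "real \<Rightarrow> ('a \<Rightarrow> complex ^ 'n ^ 'n) \<Rightarrow> 'a \<Rightarrow> complex ^ 'n \<Rightarrow> real" where
  "rho p W t x = norm (mat_powr (W t) (1 / p) *v x)"

definition averaged_norm ::
    "real \<Rightarrow> 'a::euclidean_space set \<Rightarrow> ('a \<Rightarrow> complex ^ 'n \<Rightarrow> real) \<Rightarrow> complex ^ 'n \<Rightarrow> real" where
  "averaged_norm r E \<nu> x =
     (1 / measure lebesgue E * (LINT t:E|lebesgue. \<nu> t x powr r)) powr (1 / r)"

text \<open>The size of the matrices is carried by the type \<open>'n\<close>; the scalar class is \<open>'n = 1\<close>.
  Both averaged norms below are finite by the two integrability conditions.\<close>

definition muckenhoupt_Ap ::
    "real \<Rightarrow> 'a::euclidean_space set \<Rightarrow> 'a set set \<Rightarrow> ('a \<Rightarrow> complex ^ 'n ^ 'n) set" where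
  "muckenhoupt_Ap p D S = {W. let q = p / (p - 1) in
     matrix_weight D W \<and>
     locally_integrable D W \<and>
     locally_integrable D (\<lambda>t. mat_powr (W t) (- q / p)) \<and>
     (\<exists>C. \<forall>E\<in>S. \<forall>x.
        averaged_norm q E (\<lambda>t. dual_norm (rho p W t)) x
          \<le> C * dual_norm (averaged_norm p E (rho p W)) x)}"

definition scalar_matrix :: "real \<Rightarrow> complex ^ 1 ^ 1" where
  "scalar_matrix a = (\<chi> i j. complex_of_real a)"

end

theory Submission
  imports Defs
begin

text \<open>Put \<open>\<alpha>\<^sub>k = norm (W\<^bsup>1/p\<^esup> e\<^sub>k)\<close> and \<open>\<beta>\<^sub>k = norm (W\<^bsup>-1/p\<^esup> e\<^sub>k)\<close>, so that the two diagonal entries in the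
  hypothesis are \<open>\<alpha>\<^sub>k\<^sup>2\<close> and \<open>\<beta>\<^sub>k\<^sup>2\<close>. The dual norm of \<open>x\<close> at a point is at most
  \<open>\<Sum>\<^sub>k \<bar>x\<^sub>k\<bar> \<beta>\<^sub>k\<close>, and boundedness of the products replaces \<open>\<beta>\<^sub>k\<close> by a multiple of \<open>1 / \<alpha>\<^sub>k\<close>. The scalar
  condition for the weight \<open>\<alpha>\<^sub>k\<^sup>p\<close> then bounds the average by a multiple of
  \<open>\<Sum>\<^sub>k \<bar>x\<^sub>k\<bar> / \<rho>(e\<^sub>k)\<close>, where \<open>\<rho>\<close> is the averaged norm, and each summand is at most the dual
  norm of \<open>\<rho>\<close> at \<open>x\<close>, as the test vector \<open>y = e\<^sub>k\<close> shows.\<close>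

subsection \<open>The spectral theorem for Hermitian matrices\<close>

lemma cinner_add_left: "cinner (x + y) z = cinner x z + cinner y z"
  by (simp add: cinner_def sum.distrib distrib_right)

lemma cinner_diff_left: "cinner (x - y) z = cinner x z - cinner y z"
  by (simp add: cinner_def sum_subtractf left_diff_distrib)

lemma cinner_add_right: "cinner x (y + z) = cinner x y + cinner x z"
  by (simp add: cinner_def sum.distrib distrib_left)

lemma cinner_scale_left: "cinner (c *s x) y = c * cinner x y"
  by (simp add: cinner_def sum_distrib_left mult.assoc)

lemma cinner_scale_right: "cinner x (c *s y) = cnj c * cinner x y"
  by (simp add: cinner_def sum_distrib_left mult_ac)

lemma cinner_sum_left: "cinner (\<Sum>i\<in>S. f i) y = (\<Sum>i\<in>S. cinner (f i) y)"
  by (simp add: cinner_def sum_distrib_right sum.swap[of _ S])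

lemma cinner_zero_right [simp]: "cinner x 0 = 0"
  by (simp add: cinner_def)

lemma cnj_cinner: "cnj (cinner x y) = cinner y x"
  by (simp add: cinner_def mult.commute)

lemma cinner_axis_right: "cinner x (axis k 1) = x $ k"
proof -
  have "cinner x (axis k 1) = (\<Sum>i\<in>UNIV. if i = k then x $ i else 0)"
    unfolding cinner_def axis_def by (intro sum.cong) auto
  then show ?thesis by simp
qed

lemma matrix_vector_mult_axis: "A *v axis k 1 = column k A"
  for A :: "complex ^ 'n ^ 'm"
  by (simp add: matrix_vector_mult_def column_def axis_def if_distrib cong: if_cong)

lemma cinner_same: "cinner x x = complex_of_real ((norm x)\<^sup>2)"
proof -
  have "cinner x x = complex_of_real (\<Sum>i\<in>UNIV. (cmod (x $ i))\<^sup>2)"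
    unfolding cinner_def of_real_sum by (intro sum.cong refl) (simp flip: complex_norm_square)
  also have "(\<Sum>i\<in>UNIV. (cmod (x $ i))\<^sup>2) = (norm x)\<^sup>2"
    by (simp add: norm_vec_def L2_set_def sum_nonneg)
  finally show ?thesis .
qed

lemma cmod_cinner_le: "cmod (cinner x y) \<le> norm x * norm y"
proof -
  have "cmod (cinner x y) \<le> (\<Sum>i\<in>UNIV. cmod (x $ i * cnj (y $ i)))"
    unfolding cinner_def by (rule norm_sum)
  also have "\<dots> = (\<Sum>i\<in>UNIV. \<bar>cmod (x $ i)\<bar> * \<bar>cmod (y $ i)\<bar>)"
    by (simp add: norm_mult)
  also have "\<dots> \<le> norm x * norm y"
    unfolding norm_vec_def by (rule L2_set_mult_ineq)
  finally show ?thesis .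
qed

lemma cinner_matrix_left: "cinner (A *v x) y = cinner x (ctranspose A *v y)"
proof -
  have "cinner (A *v x) y = (\<Sum>i\<in>UNIV. \<Sum>j\<in>UNIV. A $ i $ j * x $ j * cnj (y $ i))"
    by (simp add: cinner_def matrix_vector_mult_def sum_distrib_right)
  also have "\<dots> = (\<Sum>j\<in>UNIV. \<Sum>i\<in>UNIV. A $ i $ j * x $ j * cnj (y $ i))"
    by (rule sum.swap)
  also have "\<dots> = cinner x (ctranspose A *v y)"
    by (simp add: cinner_def ctranspose_def matrix_vector_mult_def sum_distrib_left mult_ac)
  finally show ?thesis .
qed

lemma continuous_on_cinner [continuous_intros]:
  assumes "continuous_on S f" "continuous_on S g"
  shows "continuous_on S (\<lambda>x. cinner (f x) (g x))"
  unfolding cinner_def using assms by (intro continuous_intros)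

lemma continuous_on_matrix_vector_mult [continuous_intros]:
  fixes A :: "complex ^ 'n ^ 'm"
  assumes "continuous_on S f"
  shows "continuous_on S (\<lambda>x. A *v f x)"
  unfolding matrix_vector_mult_def using assms by (intro continuous_intros)

lemma vector_smult_of_real: "complex_of_real c *s x = c *\<^sub>R x"
  by (simp add: vec_eq_iff) (simp add: scaleR_conv_of_real)

lemma matrix_vector_mult_scaleR_complex: "A *v (c *\<^sub>R x) = c *\<^sub>R (A *v x)"
  for A :: "complex ^ 'n ^ 'm"
  by (simp add: vector_scalar_commute flip: vector_smult_of_real)

text \<open>Fewer than \<open>CARD('n)\<close> vectors cannot span the space; a vector outside the
  span minus its orthogonal projection onto the span is the one sought.\<close>

lemma nonzero_orthogonal_vector:
  fixes u :: "'n \<Rightarrow> complex ^ 'n"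
  assumes on: "\<forall>i\<in>S. \<forall>j\<in>S. cinner (u i) (u j) = (if i = j then 1 else 0)" and S: "S \<noteq> UNIV"
  obtains v where "v \<noteq> 0" "\<forall>i\<in>S. cinner v (u i) = 0"
proof -
  have "card (u ` S) \<le> card S" by (rule card_image_le) simp
  also have "\<dots> < CARD('n)" using S by (intro psubset_card_mono) auto
  finally have "vec.span (u ` S) \<noteq> UNIV"
    using vec.dim_le_card[of UNIV "u ` S"] by (auto simp: card_cart_basis)
  then obtain x where x: "x \<notin> vec.span (u ` S)" by auto
  define w where "w = (\<Sum>i\<in>S. cinner x (u i) *s u i)"
  have "w \<in> vec.span (u ` S)"
    unfolding w_def by (intro vec.span_sum vec.span_scale vec.span_base) auto
  with x have "x - w \<noteq> 0" by auto
  moreover have "cinner (x - w) (u j) = 0" if "j \<in> S" for j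
  proof -
    have "cinner w (u j) = (\<Sum>i\<in>S. if i = j then cinner x (u i) else 0)"
      unfolding w_def cinner_sum_left cinner_scale_left using on that by (intro sum.cong) auto
    then show ?thesis using that by (simp add: cinner_diff_left)
  qed
  ultimately show thesis using that by blast
qed

text \<open>The maximiser of the Rayleigh quotient on \<open>V\<close> is an eigenvector: the Hermitian form of
  \<open>m - A\<close> is nonnegative on \<open>V\<close> and vanishes at the maximiser, hence so does its derivative.\<close>

lemma hermitian_eigenvector_in_orthogonal_complement:
  fixes A :: "complex ^ 'n ^ 'n" and u :: "'n \<Rightarrow> complex ^ 'n"
  assumes A: "ctranspose A = A"
    and ev: "\<forall>i\<in>S. A *v u i = complex_of_real (l i) *s u i"
    and v: "v \<noteq> 0" "\<forall>i\<in>S. cinner v (u i) = 0"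
  obtains x m where "norm x = 1" "\<forall>i\<in>S. cinner x (u i) = 0" "A *v x = complex_of_real m *s x"
proof -
  define V where "V = {x. \<forall>i\<in>S. cinner x (u i) = 0}"
  define K where "K = sphere 0 1 \<inter> V"
  have "closed V"
  proof -
    have "V = (\<Inter>i\<in>S. {x. cinner x (u i) = 0})" by (auto simp: V_def)
    then show ?thesis by (auto intro!: closed_INT closed_Collect_eq continuous_intros)
  qed
  then have cK: "compact K" unfolding K_def by (intro compact_Int_closed) auto
  have scaleV: "c *\<^sub>R x \<in> V" if "x \<in> V" for c x
    using that by (simp add: V_def cinner_scale_left flip: vector_smult_of_real)
  have addV: "x + y \<in> V" if "x \<in> V" "y \<in> V" for x y
    using that by (simp add: V_def cinner_add_left)
  \<comment> \<open>\<open>V\<close> is invariant because \<open>A\<close> is self-adjoint and moves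
    each \<open>u i\<close> only along itself.\<close>
  have AV: "A *v x \<in> V" if "x \<in> V" for x
    using that ev A by (simp add: V_def cinner_matrix_left cinner_scale_right)
  have vV: "v \<in> V" using v by (simp add: V_def)
  then have ne: "K \<noteq> {}"
    using v scaleV[of v "1 / norm v"] by (auto simp: K_def disjoint_iff intro!: exI[of _ "(1 / norm v) *\<^sub>R v"])
  have "\<exists>x\<in>K. \<forall>y\<in>K. Re (cinner (A *v y) y) \<le> Re (cinner (A *v x) x)"
    by (intro continuous_attains_sup cK ne continuous_intros)
  then obtain x where x: "x \<in> K"
    and max: "\<And>y. y \<in> K \<Longrightarrow> Re (cinner (A *v y) y) \<le> Re (cinner (A *v x) x)" by blast
  define m where "m = Re (cinner (A *v x) x)"
  have xV: "x \<in> V" and nx: "norm x = 1" using x by (auto simp: K_def)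
  define B where "B y = m *\<^sub>R y - A *v y" for y
  define Q where "Q y z = Re (cinner (B y) z)" for y z
  have BV: "B y \<in> V" if "y \<in> V" for y
    using addV[OF scaleV[OF that, of m] scaleV[OF AV[OF that], of "-1"]] by (simp add: B_def)
  have Q_add_left: "Q (y + z) w = Q y w + Q z w" for y z w
    by (simp add: Q_def B_def cinner_diff_left cinner_add_left matrix_vector_right_distrib
        scaleR_add_right)
  have Q_add_right: "Q w (y + z) = Q w y + Q w z" for y z w
    by (simp add: Q_def cinner_add_right)
  have Q_scale_left: "Q (c *\<^sub>R y) z = c * Q y z" for c y z
  proof -
    have "B (c *\<^sub>R y) = complex_of_real c *s B y"
      unfolding vector_smult_of_real by (simp add: B_def matrix_vector_mult_scaleR_complex scaleR_diff_right mult.commute)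
    then show ?thesis by (simp add: Q_def cinner_scale_left)
  qed
  have Q_scale_right: "Q y (c *\<^sub>R z) = c * Q y z" for c y z
    by (simp add: Q_def cinner_scale_right flip: vector_smult_of_real)
  have Q_sym: "Q y z = Q z y" for y z
  proof -
    have "Re (cinner (A *v y) z) = Re (cinner (A *v z) y)"
      using A by (metis cinner_matrix_left cnj_cinner complex_cnj(1) cnj.simps(1))
    moreover have "Re (cinner y z) = Re (cinner z y)"
      by (metis cnj_cinner cnj.simps(1))
    ultimately show ?thesis
      by (simp add: Q_def B_def cinner_diff_left cinner_scale_left flip: vector_smult_of_real)
  qed
  have Q_eq: "Q y y = m * (norm y)\<^sup>2 - Re (cinner (A *v y) y)" for y
    by (simp add: Q_def B_def cinner_diff_left cinner_scale_left cinner_same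
        flip: vector_smult_of_real)
  have Q_nonneg: "0 \<le> Q y y" if "y \<in> V" for y
  proof (cases "y = 0")
    case False
    define z where "z = (1 / norm y) *\<^sub>R y"
    have "z \<in> K" using False scaleV[OF that] by (simp add: K_def z_def)
    then have "0 \<le> Q z z" using max by (simp add: Q_eq m_def K_def)
    moreover have "Q y y = (norm y)\<^sup>2 * Q z z"
      using False by (simp add: z_def Q_scale_left Q_scale_right power2_eq_square)
    ultimately show ?thesis by simp
  qed (simp add: Q_def)
  have Q0: "Q x x = 0" by (simp add: Q_eq m_def nx)
  have "Q x (B x) = 0"
  proof -
    define b where "b = Q x (B x)"
    define c where "c = Q (B x) (B x)"
    have nn: "0 \<le> 2 * s * b + s\<^sup>2 * c" for s
    proof -
      have "0 \<le> Q (x + s *\<^sub>R B x) (x + s *\<^sub>R B x)"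
        by (intro Q_nonneg addV scaleV xV BV)
      then show ?thesis
        using Q_sym[of "B x" x]
        by (simp add: Q_add_left Q_add_right Q_scale_left Q_scale_right Q0 b_def c_def
            power2_eq_square algebra_simps)
    qed
    have c0: "0 \<le> c" unfolding c_def by (intro Q_nonneg BV xV)
    \<comment> \<open>The quadratic in \<open>s\<close> is minimal at \<open>- b / c\<close>. Since
      \<open>c\<close> may vanish, \<open>c + 1\<close> replaces it; the value at this
      \<open>s\<close> is \<open>- s\<^sup>2 * (c + 2)\<close>, which still forces
      \<open>s = 0\<close>.\<close>
    define s where "s = - b / (c + 1)"
    have b: "b = - s * (c + 1)" using c0 by (simp add: s_def)
    have "s\<^sup>2 * (c + 2) \<le> 0" using nn[of s] unfolding b by (simp add: algebra_simps power2_eq_square)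
    then have "s\<^sup>2 \<le> 0" using c0 by (simp add: mult_le_0_iff)
    then have "b = 0" by (simp add: b)
    then show ?thesis by (simp add: b_def)
  qed
  \<comment> \<open>\<open>Q x (B x)\<close> is the squared norm of \<open>B x\<close>.\<close>
  then have "B x = 0" by (simp add: Q_def cinner_same)
  then have "A *v x = complex_of_real m *s x" by (simp add: B_def vector_smult_of_real)
  with xV nx show thesis using that by (auto simp: V_def)
qed

text \<open>Induction on the set of indices already served. As long as it is not all of
  \<open>UNIV\<close>, some nonzero vector is orthogonal to the eigenvectors found so far, and their
  orthogonal complement contains a further one. Indexing by \<open>'n\<close> itself makes the case
  \<open>S = UNIV\<close> directly a family of columns.\<close>

lemma hermitian_orthonormal_eigenvectors:
  fixes A :: "complex ^ 'n ^ 'n" and S :: "'n set"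
  assumes A: "ctranspose A = A"
  shows "\<exists>u l. (\<forall>i\<in>S. A *v u i = complex_of_real (l i) *s u i) \<and>
    (\<forall>i\<in>S. \<forall>j\<in>S. cinner (u i) (u j) = (if i = j then 1 else 0))"
proof (induction S rule: finite_induct[OF finite])
  case 1
  then show ?case by simp
next
  case (2 k S)
  then obtain u :: "'n \<Rightarrow> complex ^ 'n" and l where
    ev: "\<forall>i\<in>S. A *v u i = complex_of_real (l i) *s u i" and
    on: "\<forall>i\<in>S. \<forall>j\<in>S. cinner (u i) (u j) = (if i = j then 1 else 0)" by blast
  have "S \<noteq> UNIV" using 2 by auto
  then obtain v where "v \<noteq> 0" "\<forall>i\<in>S. cinner v (u i) = 0"
    using nonzero_orthogonal_vector on by blast
  then obtain x m where x: "norm x = 1" "\<forall>i\<in>S. cinner x (u i) = 0"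
    "A *v x = complex_of_real m *s x"
    using hermitian_eigenvector_in_orthogonal_complement[OF A ev] by blast
  have "\<forall>i\<in>S. cinner (u i) x = 0" using x(2) by (metis cnj_cinner complex_cnj_zero)
  then have "(\<forall>i\<in>insert k S. A *v (u(k := x)) i = complex_of_real ((l(k := m)) i) *s (u(k := x)) i) \<and>
    (\<forall>i\<in>insert k S. \<forall>j\<in>insert k S. cinner ((u(k := x)) i) ((u(k := x)) j) = (if i = j then 1 else 0))"
    using ev on x 2(2) by (auto simp: cinner_same [of x])
  then show ?case by blast
qed

theorem hermitian_diagonalization:
  fixes A :: "complex ^ 'n ^ 'n"
  assumes A: "ctranspose A = A"
  obtains U l where "unitary U" "A = U ** real_diag l ** ctranspose U"
proof -
  obtain u :: "'n \<Rightarrow> complex ^ 'n" and l where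
    ev: "\<And>i. A *v u i = complex_of_real (l i) *s u i" and
    on: "\<And>i j. cinner (u i) (u j) = (if i = j then 1 else 0)"
    using hermitian_orthonormal_eigenvectors[OF A, of UNIV] by auto
  define U :: "complex ^ 'n ^ 'n" where "U = (\<chi> i j. u j $ i)"
  have "(ctranspose U ** U) $ i $ j = cinner (u j) (u i)" for i j
    by (simp add: matrix_matrix_mult_def ctranspose_def U_def cinner_def mult.commute)
  then have 1: "ctranspose U ** U = mat 1"
    by (simp add: vec_eq_iff on mat_def)
  then have U: "unitary U" unfolding unitary_def using matrix_left_right_inverse by blast
  have "(A ** U) $ i $ j = (A *v u j) $ i" for i j
    by (simp add: matrix_matrix_mult_def matrix_vector_mult_def U_def)
  then have "A ** U = U ** real_diag l"
    by (simp add: vec_eq_iff ev real_diag_mult_right U_def mult.commute)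
  then have "A = U ** real_diag l ** ctranspose U"
    using U unfolding unitary_def by (metis matrix_mul_assoc matrix_mul_rid)
  with U that show thesis by blast
qed

section \<open>Algebra of real powers of positive definite matrices\<close>

lemma conjugated_diag_entry:
  "(U ** real_diag l ** ctranspose U) $ i $ j =
    (\<Sum>k\<in>UNIV. complex_of_real (l k) * (U $ i $ k * cnj (U $ j $ k)))"
  by (simp add: matrix_matrix_mult_def [of "U ** real_diag l"] real_diag_mult_right ctranspose_def
      mult_ac)

lemma conjugated_diag_mult:
  assumes "unitary U"
  shows "(U ** real_diag l ** ctranspose U) ** (U ** real_diag m ** ctranspose U) =
    U ** real_diag (\<lambda>i. l i * m i) ** ctranspose U"
proof -
  have "real_diag l ** real_diag m = real_diag (\<lambda>i. l i * m i)"
    by (simp add: vec_eq_iff real_diag_mult_left) (simp add: real_diag_def)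
  moreover have "(U ** real_diag l ** ctranspose U) ** (U ** real_diag m ** ctranspose U) =
      U ** real_diag l ** (ctranspose U ** U) ** real_diag m ** ctranspose U"
    by (simp add: matrix_mul_assoc)
  moreover have "\<dots> = U ** (real_diag l ** real_diag m) ** ctranspose U"
    using assms by (simp add: unitary_def matrix_mul_assoc)
  ultimately show ?thesis by simp
qed

lemma ctranspose_conjugated_diag:
  "ctranspose (U ** real_diag l ** ctranspose U) = U ** real_diag l ** ctranspose U"
  unfolding vec_eq_iff conjugated_diag_entry ctranspose_def [of "_ ** _"]
  by (simp add: conjugated_diag_entry mult_ac)

lemma conjugated_diag_one:
  assumes "unitary U"
  shows "U ** real_diag (\<lambda>i. 1) ** ctranspose U = mat 1"
proof -
  have "real_diag (\<lambda>i. 1) = (mat 1 :: complex ^ 'a ^ 'a)"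
    by (simp add: real_diag_def mat_def vec_eq_iff)
  then show ?thesis using assms by (simp add: unitary_def)
qed

text \<open>One pair \<open>U\<close>, \<open>l\<close> serves all exponents at once, so that
  identities between powers reduce to identities between real numbers. The eigenvalue
  \<open>l i\<close> is positive as the value of the quadratic form at the \<open>i\<close>-th
  column of \<open>U\<close>.\<close>

lemma posdef_diagonalization:
  fixes A :: "complex ^ 'n ^ 'n"
  assumes "posdef A"
  obtains U l where "unitary U" "\<And>i. 0 < l i"
    "\<And>s. mat_powr A s = U ** real_diag (\<lambda>i. l i powr s) ** ctranspose U"
    "A = U ** real_diag l ** ctranspose U"
proof -
  obtain U l where U: "unitary U" and A: "A = U ** real_diag l ** ctranspose U"
    using assms hermitian_diagonalization unfolding posdef_def by blast
  have "0 < l i" for i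
  proof -
    define x where "x = U *v axis i 1"
    have x: "ctranspose U *v x = axis i 1"
      using U by (simp add: x_def matrix_vector_mul_assoc unitary_def)
    then have "x \<noteq> 0" by auto
    then have "0 < Re (cinner (A *v x) x)" using assms by (simp add: posdef_def)
    also have "cinner (A *v x) x = cinner (real_diag l *v axis i 1) (axis i 1)"
      by (simp add: A x cinner_matrix_left [of U] flip: matrix_vector_mul_assoc)
    also have "\<dots> = complex_of_real (l i)"
      by (simp add: cinner_axis_right matrix_vector_mult_axis column_def real_diag_def)
    finally show ?thesis by simp
  qed
  with U A mat_powr_eqI[OF U A] that show thesis by blast
qed

lemma mat_powr_one: "posdef A \<Longrightarrow> mat_powr A 1 = A"
  by (erule posdef_diagonalization) (simp add: less_imp_le)

lemma mat_powr_add: "posdef A \<Longrightarrow> mat_powr A (r + s) = mat_powr A r ** mat_powr A s"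
  by (erule posdef_diagonalization) (simp add: conjugated_diag_mult powr_add)

text \<open>Positivity of the eigenvalues matters here, since \<open>0 powr 0 = 0\<close>.\<close>

lemma mat_powr_zero: "posdef A \<Longrightarrow> mat_powr A 0 = mat 1"
  by (erule posdef_diagonalization) (simp add: conjugated_diag_one less_imp_neq[symmetric])

lemma ctranspose_mat_powr: "posdef A \<Longrightarrow> ctranspose (mat_powr A s) = mat_powr A s"
  by (erule posdef_diagonalization) (simp add: ctranspose_conjugated_diag)

text \<open>The power with exponent \<open>s\<close> is self-adjoint, so it can be moved across the
  inner product. This turns the diagonal entries of the hypotheses into squared norms of
  columns.\<close>

lemma norm_mat_powr_axis:
  assumes "posdef A"
  shows "mat_powr A (2 * s) $ k $ k = complex_of_real ((norm (mat_powr A s *v axis k 1))\<^sup>2)"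
proof -
  let ?x = "axis k 1 :: complex ^ 'a"
  have "complex_of_real ((norm (mat_powr A s *v ?x))\<^sup>2) = cinner (mat_powr A s *v (mat_powr A s *v ?x)) ?x"
    using ctranspose_mat_powr[OF assms, of s]
    by (simp only: cinner_matrix_left [of _ _ ?x] cinner_same [symmetric])
  also have "mat_powr A s *v (mat_powr A s *v ?x) = mat_powr A (2 * s) *v ?x"
    using mat_powr_add[OF assms, of s s] by (simp add: matrix_vector_mul_assoc)
  finally show ?thesis
    by (simp add: cinner_axis_right matrix_vector_mult_axis column_def)
qed

lemma mat_powr_mult_minus:
  assumes "posdef A"
  shows "mat_powr A s *v (mat_powr A (- s) *v x) = x"
  using mat_powr_add[OF assms, of s "- s", symmetric] mat_powr_zero[OF assms]
  by (simp add: matrix_vector_mul_assoc)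

lemma norm_mat_powr_axis_pos:
  assumes "posdef A"
  shows "0 < norm (mat_powr A s *v axis k 1)"
proof -
  have "mat_powr A s *v axis k 1 \<noteq> 0"
    using mat_powr_mult_minus[OF assms, of "-s" "axis k 1"] by (auto)
  then show ?thesis by simp
qed

lemma norm_matrix_vector_le_sum_axis:
  fixes B :: "complex ^ 'n ^ 'n"
  shows "norm (B *v x) \<le> (\<Sum>k\<in>UNIV. cmod (x $ k) * norm (B *v axis k 1))"
proof -
  have "B *v x = (\<Sum>k\<in>UNIV. x $ k *s (B *v axis k 1))"
    by (simp only: matrix_mult_sum [of B x] matrix_vector_mult_axis)
  also have "norm \<dots> \<le> (\<Sum>k\<in>UNIV. norm (x $ k *s (B *v axis k 1)))" by (rule norm_sum)
  also have "\<dots> = (\<Sum>k\<in>UNIV. cmod (x $ k) * norm (B *v axis k 1))"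
    by (simp add: norm_vec_def norm_mult L2_set_right_distrib)
  finally show ?thesis .
qed

text \<open>The diagonal of one power controls every entry of another. An entry is a combination of
  the \<open>l k powr s\<close> with coefficients of modulus at most 1, and
  \<open>l k powr s\<close> is the power \<open>s / r\<close> of \<open>l k powr r\<close>, which is
  at most the trace of the power with exponent \<open>r\<close>. Both exponents may be negative;
  only their ratio must not be.\<close>

lemma cmod_mat_powr_entry_le:
  fixes A :: "complex ^ 'n ^ 'n"
  assumes A: "posdef A" and sr: "0 \<le> s / r" "r \<noteq> 0"
  shows "cmod (mat_powr A s $ i $ j) \<le> CARD('n) * (\<Sum>k\<in>UNIV. Re (mat_powr A r $ k $ k)) powr (s / r)"
proof -
  obtain U l where U: "unitary U" and l: "\<And>i. 0 < l i" and
    pw: "\<And>s. mat_powr A s = U ** real_diag (\<lambda>i. l i powr s) ** ctranspose U"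
    using posdef_diagonalization[OF A] by blast
  have row: "(\<Sum>k\<in>UNIV. (cmod (U $ i $ k))\<^sup>2) = 1" for i
  proof -
    have "complex_of_real (\<Sum>k\<in>UNIV. (cmod (U $ i $ k))\<^sup>2) = (U ** ctranspose U) $ i $ i"
      unfolding of_real_sum matrix_matrix_mult_def ctranspose_def
      by (simp add: flip: complex_norm_square)
    also have "\<dots> = complex_of_real 1" using U by (simp add: unitary_def mat_def)
    finally show ?thesis by (simp only: of_real_eq_iff)
  qed
  have col: "(\<Sum>i\<in>UNIV. (cmod (U $ i $ k))\<^sup>2) = 1" for k
  proof -
    have "complex_of_real (\<Sum>i\<in>UNIV. (cmod (U $ i $ k))\<^sup>2) = (ctranspose U ** U) $ k $ k"
      unfolding of_real_sum matrix_matrix_mult_def ctranspose_def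
      by (simp add: mult.commute flip: complex_norm_square)
    also have "\<dots> = complex_of_real 1" using U by (simp add: unitary_def mat_def)
    finally show ?thesis by (simp only: of_real_eq_iff)
  qed
  have le1: "cmod (U $ i $ k) \<le> 1" for i k
  proof -
    have "(cmod (U $ i $ k))\<^sup>2 \<le> 1"
      unfolding row[of i, symmetric] by (rule member_le_sum) auto
    then show ?thesis by (simp add: power_le_one_iff abs_square_le_1)
  qed
  \<comment> \<open>The columns of \<open>U\<close> are unit vectors, so the trace is the sum of the
    eigenvalues.\<close>
  have trace: "(\<Sum>i\<in>UNIV. Re (mat_powr A r $ i $ i)) = (\<Sum>k\<in>UNIV. l k powr r)"
  proof -
    have "(\<Sum>i\<in>UNIV. Re (mat_powr A r $ i $ i)) =
        (\<Sum>i\<in>UNIV. \<Sum>k\<in>UNIV. l k powr r * (cmod (U $ i $ k))\<^sup>2)"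
      unfolding pw conjugated_diag_entry
      by (simp flip: complex_norm_square of_real_mult)
    also have "\<dots> = (\<Sum>k\<in>UNIV. \<Sum>i\<in>UNIV. l k powr r * (cmod (U $ i $ k))\<^sup>2)" by (rule sum.swap)
    finally show ?thesis by (simp add: col flip: sum_distrib_left)
  qed
  let ?T = "\<Sum>k\<in>UNIV. l k powr r"
  have "cmod (mat_powr A s $ i $ j) \<le>
      (\<Sum>k\<in>UNIV. cmod (complex_of_real (l k powr s) * (U $ i $ k * cnj (U $ j $ k))))"
    unfolding pw conjugated_diag_entry by (rule norm_sum)
  also have "\<dots> \<le> (\<Sum>k\<in>(UNIV::'n set). ?T powr (s / r))"
  proof (rule sum_mono)
    fix k
    have "cmod (complex_of_real (l k powr s) * (U $ i $ k * cnj (U $ j $ k))) \<le> l k powr s * 1"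
      unfolding norm_mult using le1[of i k] le1[of j k]
      by (intro mult_mono mult_le_one) auto
    also have "l k powr s * 1 = (l k powr r) powr (s / r)" using sr by (simp add: powr_powr)
    also have "\<dots> \<le> ?T powr (s / r)"
      using sr by (intro powr_mono2 member_le_sum) auto
    finally show "cmod (complex_of_real (l k powr s) * (U $ i $ k * cnj (U $ j $ k))) \<le> ?T powr (s / r)"
      by simp
  qed
  finally show ?thesis by (simp add: trace)
qed

subsection \<open>Measurability of matrix powers\<close>

primrec mat_power :: "complex ^ 'n ^ 'n \<Rightarrow> nat \<Rightarrow> complex ^ 'n ^ 'n" where
  "mat_power A 0 = mat 1"
| "mat_power A (Suc k) = A ** mat_power A k"

lemma mat_power_conjugated_diag:
  assumes "unitary U"
  shows "mat_power (U ** real_diag l ** ctranspose U) k = U ** real_diag (\<lambda>i. l i ^ k) ** ctranspose U"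
  by (induction k) (simp_all add: conjugated_diag_one conjugated_diag_mult assms)

lemma continuous_on_mat_power: "continuous_on UNIV (\<lambda>A. mat_power A k)"
  by (induction k) (auto simp: matrix_matrix_mult_def intro!: continuous_intros)

text \<open>The polynomials are chosen independently of \<open>A\<close>, which exhibits the matrix
  power as a pointwise limit of continuous functions of \<open>A\<close>. Measurability then follows
  without a measurable choice of diagonalisations.\<close>

lemma mat_powr_polynomial_limit:
  fixes s :: real
  obtains a n where "\<And>A :: complex ^ 'n ^ 'n. posdef A \<Longrightarrow>
    (\<lambda>m. \<Sum>k\<le>n m. a m k *\<^sub>R mat_power A k) \<longlonglongrightarrow> mat_powr A s"
proof -
  \<comment> \<open>Weierstrass approximation on intervals that exhaust the positive half-line, with
    error tending to 0. Each fixed positive eigenvalue lies in all but finitely many of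
    them.\<close>
  have "\<exists>c n. \<forall>x\<in>{1 / Suc m..Suc m}. \<bar>x powr s - (\<Sum>k\<le>n. c k * x ^ k)\<bar> < 1 / Suc m" for m
  proof -
    have "continuous_on {1 / real (Suc m)..real (Suc m)} (\<lambda>x. x powr s)"
    proof (intro continuous_intros ballI)
      fix x assume "x \<in> {1 / real (Suc m)..real (Suc m)}"
      moreover have "0 < 1 / real (Suc m)" by simp
      ultimately show "x \<noteq> 0" by auto
    qed
    then obtain g where "real_polynomial_function g"
      "\<And>x. x \<in> {1 / real (Suc m)..real (Suc m)} \<Longrightarrow> \<bar>x powr s - g x\<bar> < 1 / Suc m"
      using Stone_Weierstrass_real_polynomial_function[of "{1 / real (Suc m)..real (Suc m)}" "\<lambda>x. x powr s" "1 / Suc m"]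
      by auto
    then show ?thesis unfolding real_polynomial_function_iff_sum by fastforce
  qed
  then obtain a n where an: "\<And>m x. x \<in> {1 / Suc m..Suc m} \<Longrightarrow>
      \<bar>x powr s - (\<Sum>k\<le>n m. a m k * x ^ k)\<bar> < 1 / Suc m"
    by metis
  have lim: "(\<lambda>m. \<Sum>k\<le>n m. a m k * x ^ k) \<longlonglongrightarrow> x powr s" if "0 < x" for x :: real
  proof (rule LIM_zero_cancel, rule tendsto_0_le [where K = 1])
    show "(\<lambda>m. 1 / real (Suc m)) \<longlonglongrightarrow> 0" by (rule lim_1_over_n[THEN LIMSEQ_Suc])
    have "\<forall>\<^sub>F m in sequentially. 1 / real (Suc m) < x"
      using order_tendstoD(2)[OF lim_1_over_n[THEN LIMSEQ_Suc] that] .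
    moreover have "\<forall>\<^sub>F m in sequentially. x < real (Suc m)"
      using eventually_gt_at_top[of "nat \<lceil>x\<rceil>"] by eventually_elim linarith
    ultimately show "\<forall>\<^sub>F m in sequentially.
        norm ((\<Sum>k\<le>n m. a m k * x ^ k) - x powr s) \<le> norm (1 / real (Suc m)) * 1"
    proof eventually_elim
      case (elim m)
      then show ?case using an[of x m] by (simp add: abs_minus_commute)
    qed
  qed
  show thesis
  proof (rule that)
    fix A :: "complex ^ 'n ^ 'n"
    assume "posdef A"
    then obtain U l where U: "unitary U" and l: "\<And>i. 0 < l i" and
      pw: "mat_powr A s = U ** real_diag (\<lambda>i. l i powr s) ** ctranspose U" and
      A: "A = U ** real_diag l ** ctranspose U"
      using posdef_diagonalization by metis
    have entry: "(\<Sum>k\<le>n m. a m k *\<^sub>R mat_power A k) $ i $ j =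
        (\<Sum>r\<in>UNIV. complex_of_real (\<Sum>k\<le>n m. a m k * l r ^ k) * (U $ i $ r * cnj (U $ j $ r)))"
      for m i j
    proof -
      have "(\<Sum>k\<le>n m. a m k *\<^sub>R mat_power A k) $ i $ j = (\<Sum>k\<le>n m. \<Sum>r\<in>UNIV.
          complex_of_real (a m k * l r ^ k) * (U $ i $ r * cnj (U $ j $ r)))"
        unfolding A mat_power_conjugated_diag[OF U]
        by (simp only: sum_component vector_scaleR_component conjugated_diag_entry)
           (simp add: scaleR_conv_of_real sum_distrib_left mult.assoc)
      also have "\<dots> = (\<Sum>r\<in>UNIV. \<Sum>k\<le>n m.
          complex_of_real (a m k * l r ^ k) * (U $ i $ r * cnj (U $ j $ r)))"
        by (rule sum.swap)
      finally show ?thesis unfolding of_real_sum sum_distrib_right .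
    qed
    show "(\<lambda>m. \<Sum>k\<le>n m. a m k *\<^sub>R mat_power A k) \<longlonglongrightarrow> mat_powr A s"
    proof (intro vec_tendstoI)
      fix i j
      show "(\<lambda>m. (\<Sum>k\<le>n m. a m k *\<^sub>R mat_power A k) $ i $ j) \<longlonglongrightarrow> mat_powr A s $ i $ j"
        unfolding entry pw conjugated_diag_entry
        by (intro tendsto_intros lim l)
    qed
  qed
qed

lemma borel_measurable_mat_powr:
  fixes W :: "'a::euclidean_space \<Rightarrow> complex ^ 'n ^ 'n"
  assumes D: "D \<in> sets lebesgue" and W: "matrix_weight D W"
  shows "(\<lambda>t. mat_powr (W t) s) \<in> borel_measurable (lebesgue_on D)"
proof -
  define P where "P = {t \<in> D. posdef (W t)}"
  have ae: "AE t in lebesgue. t \<in> D \<longrightarrow> posdef (W t)"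
    using W D by (simp add: matrix_weight_def AE_restrict_space_iff)
  \<comment> \<open>\<open>P\<close> differs from \<open>D\<close> by a null set, and Lebesgue
    measure is complete.\<close>
  have "P \<in> sets lebesgue"
    by (rule completion.in_sets_AE[OF _ D]) (use ae in \<open>auto simp: P_def\<close>)
  define W' where "W' t = (if t \<in> D then W t else 0)" for t
  have [measurable]: "W' \<in> borel_measurable lebesgue"
    using W D unfolding W'_def matrix_weight_def by (simp add: borel_measurable_if)
  obtain a n where lim: "\<And>A :: complex ^ 'n ^ 'n. posdef A \<Longrightarrow>
      (\<lambda>m. \<Sum>k\<le>n m. a m k *\<^sub>R mat_power A k) \<longlonglongrightarrow> mat_powr A s"
    using mat_powr_polynomial_limit[where s = s] by blast
  define F where "F m t = (if t \<in> P then \<Sum>k\<le>n m. a m k *\<^sub>R mat_power (W' t) k else 0)" for m t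
  have [measurable]: "(\<lambda>t. mat_power (W' t) k) \<in> borel_measurable lebesgue" for k
    using borel_measurable_continuous_onI[OF continuous_on_mat_power]
    by (rule measurable_compose[rotated]) simp
  have "F m \<in> borel_measurable lebesgue" for m
    unfolding F_def using \<open>P \<in> sets lebesgue\<close> by (intro measurable_If_set) auto
  moreover have "(\<lambda>m. F m t) \<longlonglongrightarrow> (if t \<in> P then mat_powr (W t) s else 0)" for t
    unfolding F_def using lim[of "W t"] by (auto simp: P_def W'_def)
  ultimately have "(\<lambda>t. if t \<in> P then mat_powr (W t) s else 0) \<in> borel_measurable lebesgue"
    by (rule borel_measurable_LIMSEQ_metric)
  then have "(\<lambda>t. if t \<in> D then mat_powr (W t) s else 0) \<in> borel_measurable lebesgue"
    by (rule borel_measurable_AE) (use ae in \<open>auto simp: P_def\<close>)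
  then show ?thesis
    using D by (simp add: borel_measurable_if)
qed

subsection \<open>Pointwise estimates\<close>

text \<open>Bounding each \<open>c k\<close> by \<open>?T powr (1 / e)\<close> treats
  \<open>e < 1\<close> and \<open>e > 1\<close> alike, without convexity.\<close>

lemma sum_powr_le:
  fixes c :: "'n::finite \<Rightarrow> real"
  assumes e: "0 < e" and c: "\<And>k. 0 \<le> c k"
  shows "(\<Sum>k\<in>UNIV. c k) powr e \<le> CARD('n) powr e * (\<Sum>k\<in>UNIV. c k powr e)"
proof -
  let ?T = "\<Sum>k\<in>UNIV. c k powr e"
  have T: "0 \<le> ?T" by (intro sum_nonneg) auto
  have "(\<Sum>k\<in>UNIV. c k) \<le> (\<Sum>k\<in>(UNIV::'n set). ?T powr (1 / e))"
  proof (rule sum_mono)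
    fix k
    have "c k = (c k powr e) powr (1 / e)" using e c[of k] by (simp add: powr_powr)
    also have "\<dots> \<le> ?T powr (1 / e)" using e by (intro powr_mono2 member_le_sum) auto
    finally show "c k \<le> ?T powr (1 / e)" .
  qed
  then have "(\<Sum>k\<in>UNIV. c k) powr e \<le> (CARD('n) * ?T powr (1 / e)) powr e"
    using e c by (intro powr_mono2 sum_nonneg) auto
  also have "\<dots> = CARD('n) powr e * ?T"
    using e T by (simp add: powr_mult powr_powr)
  finally show ?thesis .
qed

lemma norm_matrix_le_sum_entries:
  fixes A :: "complex ^ 'n ^ 'm"
  shows "norm A \<le> (\<Sum>i\<in>UNIV. \<Sum>j\<in>UNIV. cmod (A $ i $ j))"
proof -
  have "norm A \<le> (\<Sum>i\<in>UNIV. norm (A $ i))"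
    unfolding norm_vec_def[of A] by (intro L2_set_le_sum) auto
  also have "\<dots> \<le> (\<Sum>i\<in>UNIV. \<Sum>j\<in>UNIV. cmod (A $ i $ j))"
    unfolding norm_vec_def by (intro sum_mono L2_set_le_sum) auto
  finally show ?thesis .
qed

text \<open>The cube counts the entries, of which there are \<open>CARD('n)\<close> squared, times
  the factor in the bound for each. Moving the power inside the sum leaves multiples of scalar
  weights whose integrability is known.\<close>

lemma norm_mat_powr_le:
  fixes A :: "complex ^ 'n ^ 'n"
  assumes A: "posdef A" and sr: "0 < s / r"
  shows "norm (mat_powr A s) \<le>
    CARD('n) ^ 3 * CARD('n) powr (s / r) * (\<Sum>k\<in>UNIV. Re (mat_powr A r $ k $ k) powr (s / r))"
proof -
  have nn: "0 \<le> Re (mat_powr A r $ k $ k)" for k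
    using norm_mat_powr_axis[OF A, of "r / 2" k] by simp
  have "norm (mat_powr A s) \<le> (\<Sum>i\<in>UNIV. \<Sum>j\<in>UNIV. cmod (mat_powr A s $ i $ j))"
    by (rule norm_matrix_le_sum_entries)
  also have "\<dots> \<le> (\<Sum>i\<in>(UNIV::'n set). \<Sum>j\<in>(UNIV::'n set). CARD('n) * (\<Sum>k\<in>UNIV. Re (mat_powr A r $ k $ k)) powr (s / r))"
    using sr by (intro sum_mono cmod_mat_powr_entry_le A) auto
  also have "\<dots> = CARD('n) ^ 3 * (\<Sum>k\<in>UNIV. Re (mat_powr A r $ k $ k)) powr (s / r)"
    by (simp add: power3_eq_cube)
  also have "\<dots> \<le> CARD('n) ^ 3 * (CARD('n) powr (s / r) * (\<Sum>k\<in>UNIV. Re (mat_powr A r $ k $ k) powr (s / r)))"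
    by (intro mult_left_mono sum_powr_le sr nn) auto
  finally show ?thesis by (simp add: mult.assoc)
qed

text \<open>Cauchy-Schwarz, after inserting the power with exponent \<open>1 / p\<close> and its
  inverse and moving the former to \<open>y\<close>.\<close>

lemma cmod_cinner_le_rho:
  assumes A: "posdef (W t)"
  shows "cmod (cinner x y) \<le> rho p W t y * norm (mat_powr (W t) (- (1 / p)) *v x)"
proof -
  have "cinner x y = cinner (mat_powr (W t) (1 / p) *v (mat_powr (W t) (- (1 / p)) *v x)) y"
    by (simp add: mat_powr_mult_minus[OF A])
  also have "\<dots> = cinner (mat_powr (W t) (- (1 / p)) *v x) (mat_powr (W t) (1 / p) *v y)"
    by (subst cinner_matrix_left) (simp add: ctranspose_mat_powr[OF A])
  finally show ?thesis unfolding rho_def by (metis cmod_cinner_le mult.commute)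
qed

lemma dual_norm_rho:
  fixes W :: "'a \<Rightarrow> complex ^ 'n ^ 'n"
  assumes A: "posdef (W t)"
  shows dual_norm_rho_le: "dual_norm (rho p W t) x \<le> norm (mat_powr (W t) (- (1 / p)) *v x)"
    and dual_norm_rho_nonneg: "0 \<le> dual_norm (rho p W t) x"
proof -
  have le: "cmod (cinner x y) / rho p W t y \<le> norm (mat_powr (W t) (- (1 / p)) *v x)" for y
    using cmod_cinner_le_rho[where W = W and t = t and x = x and y = y and p = p] A
    by (cases "rho p W t y = 0") (auto simp: rho_def divide_le_eq mult.commute)
  \<comment> \<open>An arbitrary basis vector: it makes the index set of the supremum nonempty and
    supplies a nonnegative element.\<close>
  have ax: "axis undefined 1 \<in> {y :: complex ^ 'n. y \<noteq> 0}" by simp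
  then have "{y :: complex ^ 'n. y \<noteq> 0} \<noteq> {}" by blast
  then show "dual_norm (rho p W t) x \<le> norm (mat_powr (W t) (- (1 / p)) *v x)"
    unfolding dual_norm_def by (rule cSUP_least) (rule le)
  have "0 \<le> cmod (cinner x (axis undefined 1)) / rho p W t (axis undefined 1)"
    by (simp add: rho_def)
  also have "\<dots> \<le> dual_norm (rho p W t) x"
    unfolding dual_norm_def using le by (intro cSUP_upper ax bdd_aboveI2)
  finally show "0 \<le> dual_norm (rho p W t) x" .
qed

text \<open>This trades \<beta> for 1 / \<alpha>: the hypothesis says that the product of their
  squares is at most \<open>M\<close>, and raising it to the power \<open>q / 2\<close> gives a
  bound by \<open>\<alpha> powr (- q)\<close>, which is the power \<open>- q / p\<close> of the
  scalar weight \<open>\<alpha> powr p\<close>.\<close>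

lemma norm_mat_powr_minus_axis_le:
  assumes A: "posdef A" and p: "0 < p" and q: "0 < q"
    and M: "cmod (mat_powr A (2 / p) $ k $ k * mat_powr A (- 2 / p) $ k $ k) \<le> M"
  shows "norm (mat_powr A (- (1 / p)) *v axis k 1) powr q
    \<le> M powr (q / 2) * (Re (mat_powr A (2 / p) $ k $ k) powr (p / 2)) powr (- q / p)"
proof -
  define \<alpha> where "\<alpha> = norm (mat_powr A (1 / p) *v axis k 1)"
  define \<beta> where "\<beta> = norm (mat_powr A (- (1 / p)) *v axis k 1)"
  have pos: "0 < \<alpha>" "0 < \<beta>" unfolding \<alpha>_def \<beta>_def by (intro norm_mat_powr_axis_pos A)+
  have a: "mat_powr A (2 / p) $ k $ k = complex_of_real (\<alpha>\<^sup>2)"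
    using norm_mat_powr_axis[OF A, of "1 / p" k] by (simp add: \<alpha>_def)
  have b: "mat_powr A (- 2 / p) $ k $ k = complex_of_real (\<beta>\<^sup>2)"
    using norm_mat_powr_axis[OF A, of "- (1 / p)" k] by (simp add: \<beta>_def)
  have "\<alpha>\<^sup>2 * \<beta>\<^sup>2 \<le> M" using M unfolding a b by (simp add: norm_mult norm_power)
  then have "(\<alpha>\<^sup>2 * \<beta>\<^sup>2) powr (q / 2) \<le> M powr (q / 2)" using q by (intro powr_mono2) auto
  moreover have sq: "(x\<^sup>2) powr (q / 2) = x powr q" if "0 < x" for x :: real
    using that by (simp add: powr_powr flip: powr_numeral)
  ultimately have "\<alpha> powr q * \<beta> powr q \<le> M powr (q / 2)"
    by (simp add: powr_mult sq pos)
  then have "\<beta> powr q \<le> M powr (q / 2) * \<alpha> powr (- q)"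
    using pos by (simp add: powr_minus field_simps)
  also have "\<alpha> powr (- q) = (Re (mat_powr A (2 / p) $ k $ k) powr (p / 2)) powr (- q / p)"
    using pos p by (simp add: a powr_powr flip: powr_numeral)
  finally show ?thesis by (simp add: \<beta>_def)
qed

lemma norm_mat_powr_minus_le:
  fixes A :: "complex ^ 'n ^ 'n"
  assumes A: "posdef A" and p: "0 < p" and q: "0 < q"
    and M: "\<And>k. cmod (mat_powr A (2 / p) $ k $ k * mat_powr A (- 2 / p) $ k $ k) \<le> M"
  shows "norm (mat_powr A (- (1 / p)) *v x) powr q \<le> CARD('n) powr q * M powr (q / 2) *
    (\<Sum>k\<in>UNIV. cmod (x $ k) powr q * (Re (mat_powr A (2 / p) $ k $ k) powr (p / 2)) powr (- q / p))"
proof -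
  let ?b = "\<lambda>k. norm (mat_powr A (- (1 / p)) *v axis k 1)"
  let ?v = "\<lambda>k. (Re (mat_powr A (2 / p) $ k $ k) powr (p / 2)) powr (- q / p)"
  have "norm (mat_powr A (- (1 / p)) *v x) powr q \<le> (\<Sum>k\<in>UNIV. cmod (x $ k) * ?b k) powr q"
    using q by (intro powr_mono2 norm_matrix_vector_le_sum_axis) auto
  also have "\<dots> \<le> CARD('n) powr q * (\<Sum>k\<in>UNIV. (cmod (x $ k) * ?b k) powr q)"
    by (intro sum_powr_le q) auto
  also have "\<dots> \<le> CARD('n) powr q * (\<Sum>k\<in>UNIV. cmod (x $ k) powr q * (M powr (q / 2) * ?v k))"
    unfolding powr_mult
    by (intro mult_left_mono sum_mono norm_mat_powr_minus_axis_le A p q M) auto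
  also have "\<dots> = CARD('n) powr q * M powr (q / 2) * (\<Sum>k\<in>UNIV. cmod (x $ k) powr q * ?v k)"
    by (simp add: sum_distrib_left mult_ac)
  finally show ?thesis .
qed

subsection \<open>Averages and local integrability\<close>

lemma averaged_norm_lebesgue_on:
  assumes "E \<in> sets lebesgue"
  shows "averaged_norm r E \<nu> x =
    (1 / measure lebesgue E * (LINT t|lebesgue_on E. \<nu> t x powr r)) powr (1 / r)"
  using assms by (simp add: averaged_norm_def set_lebesgue_integral_def integral_restrict_space)

lemma set_integrable_iff_lebesgue_on:
  fixes f :: "'a::euclidean_space \<Rightarrow> 'b::euclidean_space"
  assumes "E \<in> sets lebesgue"
  shows "set_integrable lebesgue E f \<longleftrightarrow> integrable (lebesgue_on E) f"
  using assms by (simp add: set_integrable_def integrable_restrict_space)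

lemma locally_integrableD:
  fixes f :: "'a::euclidean_space \<Rightarrow> 'b::euclidean_space"
  assumes f: "locally_integrable D f" and E: "E \<in> sets lebesgue" "bounded E" "E \<subseteq> D"
  shows "integrable (lebesgue_on E) f"
proof -
  have "set_integrable lebesgue (D \<inter> closure E) f"
    using f E by (auto simp: locally_integrable_def compact_closure)
  \<comment> \<open>\<open>closure E\<close> is compact but may leave \<open>D\<close>, as happens
    for the half-open torus; the compact sets in \<open>locally_integrable\<close> range over the
    ambient space.\<close>
  then have "set_integrable lebesgue E f"
    by (rule set_integrable_subset) (use E closure_subset in auto)
  then show ?thesis using E by (simp add: set_integrable_iff_lebesgue_on)
qed

lemma locally_integrable_bound:
  fixes f :: "'a::euclidean_space \<Rightarrow> 'b::euclidean_space"
  assumes D: "D \<in> sets lebesgue" and f: "f \<in> borel_measurable (lebesgue_on D)"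
    and g: "\<And>k. locally_integrable D (g k)"
    and le: "AE t in lebesgue_on D. norm (f t) \<le> c * (\<Sum>k\<in>(UNIV::'n::finite set). g k t)"
  shows "locally_integrable D f"
  unfolding locally_integrable_def
proof (intro allI impI)
  fix K :: "'a set"
  assume "compact K"
  then have E: "D \<inter> K \<in> sets lebesgue" using D lmeasurable_compact[of K] by auto
  have g': "integrable (lebesgue_on (D \<inter> K)) (g k)" for k
    using g[of k] \<open>compact K\<close> E by (simp add: locally_integrable_def flip: set_integrable_iff_lebesgue_on)
  have "integrable (lebesgue_on (D \<inter> K)) f"
  proof (rule Bochner_Integration.integrable_bound)
    show "integrable (lebesgue_on (D \<inter> K)) (\<lambda>t. c * (\<Sum>k\<in>(UNIV::'n set). g k t))"
      using g' by auto
    show "f \<in> borel_measurable (lebesgue_on (D \<inter> K))"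
      using f by (rule measurable_restrict_mono) auto
    show "AE t in lebesgue_on (D \<inter> K). norm (f t) \<le> norm (c * (\<Sum>k\<in>UNIV. g k t))"
      using le E D by (auto simp: AE_restrict_space_iff elim!: eventually_mono)
  qed
  then show "set_integrable lebesgue (D \<inter> K) f"
    using E by (simp add: set_integrable_iff_lebesgue_on)
qed

subsection \<open>Scalar weights as one-dimensional matrix weights\<close>

lemma scalar_matrix_mult: "scalar_matrix a *v x = a *\<^sub>R x"
  by (simp add: vec_eq_iff scalar_matrix_def matrix_vector_mult_def UNIV_1) (simp add: scaleR_conv_of_real)

lemma norm_complex_1: "norm x = cmod (x $ 1)" for x :: "complex ^ 1"
  by (simp add: norm_vec_def L2_set_def UNIV_1)

lemma mat_powr_scalar_matrix: "mat_powr (scalar_matrix a) s = scalar_matrix (a powr s)"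
proof -
  have sc: "scalar_matrix a = mat 1 ** real_diag (\<lambda>i. a) ** ctranspose (mat 1)" for a
    unfolding vec_eq_iff forall_1 conjugated_diag_entry UNIV_1 by (simp add: scalar_matrix_def mat_def)
  have "unitary (mat 1 :: complex ^ 1 ^ 1)"
    by (simp add: unitary_def vec_eq_iff forall_1 matrix_matrix_mult_def UNIV_1 ctranspose_def mat_def)
  from mat_powr_eqI[OF this sc] show ?thesis by (simp only: sc)
qed

text \<open>In dimension one the quotient does not depend on \<open>y\<close>. For
  \<open>c = 0\<close> both sides are 0, division by zero being 0.\<close>

lemma dual_norm_scaled_norm:
  fixes x :: "complex ^ 1"
  assumes nu: "\<And>y :: complex ^ 1. \<nu> y = c * norm y"
  shows "dual_norm \<nu> x = norm x / c"
proof -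
  have "cmod (cinner x y) / \<nu> y = norm x / c" if "y \<noteq> 0" for y
    using that by (auto simp: nu norm_complex_1 cinner_def UNIV_1 norm_mult vec_eq_iff forall_1)
  then have "dual_norm \<nu> x = (SUP y\<in>{y :: complex ^ 1. y \<noteq> 0}. norm x / c)"
    unfolding dual_norm_def by (intro SUP_cong) auto
  moreover have "(axis 1 1 :: complex ^ 1) \<in> {y. y \<noteq> 0}" by simp
  ultimately show ?thesis by (metis cSUP_const empty_iff)
qed

text \<open>Testing the one-dimensional matrix condition on a unit vector recovers the classical
  scalar condition, in the quotient form produced by the dual norm.\<close>

lemma scalar_muckenhouptE:
  fixes v :: "'a::euclidean_space \<Rightarrow> real"
  assumes p: "1 < p" and q: "q = p / (p - 1)" and v: "\<And>t. 0 \<le> v t"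
    and S: "\<And>E. E \<in> S \<Longrightarrow> E \<in> sets lebesgue"
    and A: "(\<lambda>t. scalar_matrix (v t)) \<in> muckenhoupt_Ap p D S"
  obtains C where "0 \<le> C" "locally_integrable D v" "locally_integrable D (\<lambda>t. v t powr (- q / p))"
    "\<And>E. E \<in> S \<Longrightarrow> (1 / measure lebesgue E * (LINT t|lebesgue_on E. v t powr (- q / p))) powr (1 / q)
      \<le> C / (1 / measure lebesgue E * (LINT t|lebesgue_on E. v t)) powr (1 / p)"
proof -
  let ?V = "\<lambda>t. scalar_matrix (v t)"
  from A obtain C where
    loc: "locally_integrable D ?V" "locally_integrable D (\<lambda>t. scalar_matrix (v t powr (- q / p)))" and
    C: "\<And>E x. E \<in> S \<Longrightarrow> averaged_norm q E (\<lambda>t. dual_norm (rho p ?V t)) x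
          \<le> C * dual_norm (averaged_norm p E (rho p ?V)) x"
    unfolding muckenhoupt_Ap_def Let_def q[symmetric] by (auto simp: mat_powr_scalar_matrix)
  have entry: "locally_integrable D h" if "locally_integrable D (\<lambda>t. scalar_matrix (h t))"
    for h :: "'a \<Rightarrow> real"
    unfolding locally_integrable_def set_integrable_def
  proof (intro allI impI)
    fix K :: "'a set"
    assume "compact K"
    then have "integrable lebesgue (\<lambda>t. indicat_real (D \<inter> K) t *\<^sub>R scalar_matrix (h t))"
      using that by (simp add: locally_integrable_def set_integrable_def)
    moreover have "bounded_linear (\<lambda>A :: complex ^ 1 ^ 1. Re (A $ 1 $ 1))"
      by (rule bounded_linear_compose[OF bounded_linear_Re
            bounded_linear_compose[OF bounded_linear_vec_nth bounded_linear_vec_nth]])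
    ultimately have "integrable lebesgue (\<lambda>t. Re ((indicat_real (D \<inter> K) t *\<^sub>R scalar_matrix (h t)) $ 1 $ 1))"
      by (rule integrable_bounded_linear[rotated])
    then show "integrable lebesgue (\<lambda>t. indicat_real (D \<inter> K) t *\<^sub>R h t)"
      by (simp add: scalar_matrix_def)
  qed
  have rho: "rho p ?V t y = v t powr (1 / p) * norm y" for t y
    by (simp add: rho_def mat_powr_scalar_matrix scalar_matrix_mult)
  let ?x = "axis 1 1 :: complex ^ 1"
  have nx: "norm ?x = 1" by (simp add: norm_axis_1)
  have dual: "dual_norm (rho p ?V t) ?x powr q = v t powr (- q / p)" for t
    by (simp add: dual_norm_scaled_norm[where c = "v t powr (1 / p)"] rho nx powr_divide
        powr_powr powr_minus_divide)
  let ?avg = "\<lambda>E h. 1 / measure lebesgue E * (LINT t|lebesgue_on E. h t)"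
  have avg: "averaged_norm p E (rho p ?V) y = ?avg E v powr (1 / p) * norm y" if "E \<in> S" for E y
  proof -
    have "rho p ?V t y powr p = v t * norm y powr p" for t
      using p v[of t] by (simp add: rho powr_mult powr_powr)
    then have "averaged_norm p E (rho p ?V) y = (?avg E v * norm y powr p) powr (1 / p)"
      using S[OF that] by (simp add: averaged_norm_lebesgue_on)
    also have "\<dots> = ?avg E v powr (1 / p) * (norm y powr p) powr (1 / p)"
      by (rule powr_mult)
    finally show ?thesis using p by (simp add: powr_powr)
  qed
  show thesis
  proof (rule that)
    \<comment> \<open>The constant in the definition may be negative; a nonnegative one is required
      for later products and powers.\<close>
    show "0 \<le> max C 0" by simp
    fix E assume E: "E \<in> S"
    have "?avg E (\<lambda>t. v t powr (- q / p)) powr (1 / q) = averaged_norm q E (\<lambda>t. dual_norm (rho p ?V t)) ?x"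
      using S[OF E] by (simp add: averaged_norm_lebesgue_on dual)
    also have "\<dots> \<le> C * dual_norm (averaged_norm p E (rho p ?V)) ?x" by (rule C[OF E])
    also have "\<dots> = C / ?avg E v powr (1 / p)"
      by (subst dual_norm_scaled_norm[OF avg[OF E]]) (simp_all add: nx)
    also have "\<dots> \<le> max C 0 / ?avg E v powr (1 / p)"
      by (intro divide_right_mono) auto
    finally show "?avg E (\<lambda>t. v t powr (- q / p)) powr (1 / q) \<le> max C 0 / ?avg E v powr (1 / p)" .
  qed (use loc entry in auto)
qed

subsection \<open>The matrix condition from the scalar conditions\<close>

text \<open>By Hoelder's inequality, the dual norm of an averaged norm is a supremum of a bounded set.
  Homogeneity reduces this to vectors of averaged norm one, where Young's inequality suffices.\<close>

lemma bdd_above_dual_averaged_norm: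
  fixes W :: "'a::euclidean_space \<Rightarrow> complex ^ 'n ^ 'n"
  assumes p: "1 < p" and q: "q = p / (p - 1)" and E: "E \<in> sets lebesgue"
    and pd: "AE t in lebesgue_on E. posdef (W t)"
    and G: "integrable (lebesgue_on E) G"
    and le: "AE t in lebesgue_on E. norm (mat_powr (W t) (- (1 / p)) *v x) powr q \<le> G t"
  shows "bdd_above ((\<lambda>y. cmod (cinner x y) / averaged_norm p E (rho p W) y) ` {y. y \<noteq> 0})"
proof -
  let ?e = "measure lebesgue E"
  \<comment> \<open>Young's inequality is averaged over \<open>E\<close>: the first term contributes
    exactly \<open>1 / p\<close> because \<open>rho\<close> is divided by its averaged norm, the
    second at most the average of \<open>G\<close> divided by \<open>q\<close>.\<close>
  let ?K = "1 / p + (LINT t|lebesgue_on E. G t) / (q * ?e)"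
  have q1: "1 < q" and pq: "1 / p + 1 / q = 1" using p by (auto simp: q field_simps)
  \<comment> \<open>The maximum with 0 covers a vanishing averaged norm, where the quotient is 0 by
    convention.\<close>
  have "cmod (cinner x y) / averaged_norm p E (rho p W) y \<le> max 0 ?K" for y
  proof (cases "averaged_norm p E (rho p W) y = 0")
    case False
    define R where "R = averaged_norm p E (rho p W) y"
    define I where "I = (LINT t|lebesgue_on E. rho p W t y powr p)"
    have R: "R = (1 / ?e * I) powr (1 / p)" unfolding R_def I_def by (rule averaged_norm_lebesgue_on[OF E])
    have R0: "0 < R" using False R by (simp add: R_def)
    have e0: "0 < ?e" and I0: "I \<noteq> 0" using R0 unfolding R by (auto simp: zero_less_measure_iff)
    have "0 \<le> I" unfolding I_def by (intro integral_nonneg_AE) auto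
    then have Rp: "R powr p = I / ?e" using p I0 e0 by (simp add: R powr_powr)
    \<comment> \<open>Default values are turned into information: the integral of a nonintegrable
      function is 0, so \<open>I \<noteq> 0\<close> gives integrability; likewise
      \<open>measure\<close> is 0 on sets of infinite measure, so \<open>0 < ?e\<close> gives
      finiteness.\<close>
    have int: "integrable (lebesgue_on E) (\<lambda>t. rho p W t y powr p)"
      using I0 unfolding I_def by (rule contrapos_np) (rule not_integrable_integral_eq)
    have fin: "finite_measure (lebesgue_on E)"
      using E e0 by (intro finite_measure_lebesgue_on) (auto simp: fmeasurable_def measure_def enn2real_positive_iff)
    have "(LINT t|lebesgue_on E. cmod (cinner x y) / R)
        \<le> (LINT t|lebesgue_on E. rho p W t y powr p / (R powr p * p) + G t / q)"
    proof (rule integral_mono_AE)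
      show "AE t in lebesgue_on E. cmod (cinner x y) / R \<le> rho p W t y powr p / (R powr p * p) + G t / q"
        using pd le
      proof eventually_elim
        case (elim t)
        let ?r = "norm (mat_powr (W t) (- (1 / p)) *v x)"
        have r: "0 \<le> rho p W t y" by (simp add: rho_def)
        have "cmod (cinner x y) / R \<le> (rho p W t y / R) * ?r"
          using cmod_cinner_le_rho[where W = W and t = t and x = x and y = y and p = p] elim(1) R0 by (simp add: divide_right_mono)
        also have "\<dots> \<le> (rho p W t y / R) powr p / p + ?r powr q / q"
          using p q1 pq r R0 by (intro Youngs_inequality) auto
        also have "(rho p W t y / R) powr p / p = rho p W t y powr p / (R powr p * p)"
          using r R0 by (simp add: powr_divide)
        also have "?r powr q / q \<le> G t / q" using elim(2) q1 by (intro divide_right_mono) auto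
        finally show ?case by simp
      qed
    qed (use int G fin in \<open>auto simp: finite_measure.integrable_const\<close>)
    also have "\<dots> = I / (R powr p * p) + (LINT t|lebesgue_on E. G t) / q"
      using int G by (simp add: I_def)
    also have "\<dots> = ?e * ?K"
      using I0 e0 q1 p by (simp add: Rp field_simps)
    also have "(LINT t|lebesgue_on E. cmod (cinner x y) / R) = ?e * (cmod (cinner x y) / R)"
      using E by (simp add: measure_restrict_space)
    finally have "cmod (cinner x y) / R \<le> ?K" using e0 by (simp only: mult_le_cancel_left_pos)
    then show ?thesis by (simp add: R_def)
  qed auto
  then show ?thesis by (intro bdd_aboveI2)
qed

lemma dual_norm_upper:
  assumes "bdd_above ((\<lambda>y. cmod (cinner x y) / \<nu> y) ` {y. y \<noteq> 0})" "y \<noteq> 0"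
  shows "cmod (cinner x y) / \<nu> y \<le> dual_norm \<nu> x"
  unfolding dual_norm_def using assms by (intro cSUP_upper) auto

text \<open>The family \<open>S\<close> enters only through measurability, boundedness and inclusion
  in \<open>D\<close>, so that one proof serves all four domains.\<close>

theorem muckenhoupt_Ap_if_diagonal:
  fixes W :: "'a::euclidean_space \<Rightarrow> complex ^ 'n ^ 'n"
  assumes p: "1 < p" and D: "D \<in> sets lebesgue"
    and S: "\<And>E. E \<in> S \<Longrightarrow> E \<in> sets lebesgue \<and> bounded E \<and> E \<subseteq> D"
    and W: "matrix_weight D W"
    and Linf: "\<And>k. (\<lambda>t. mat_powr (W t) (2 / p) $ k $ k * mat_powr (W t) (- 2 / p) $ k $ k) \<in> Linfty D"
    and scal: "\<And>k. (\<lambda>t. scalar_matrix (Re (mat_powr (W t) (2 / p) $ k $ k) powr (p / 2)))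
                 \<in> muckenhoupt_Ap p D S"
  shows "W \<in> muckenhoupt_Ap p D S"
proof -
  define q where "q = p / (p - 1)"
  have q0: "0 < q" using p by (simp add: q_def)
  define v where "v k t = Re (mat_powr (W t) (2 / p) $ k $ k) powr (p / 2)" for k t
  have v0: "0 \<le> v k t" for k t by (simp add: v_def)
  have "\<exists>C. 0 \<le> C \<and> locally_integrable D (v k) \<and> locally_integrable D (\<lambda>t. v k t powr (- q / p)) \<and>
      (\<forall>E\<in>S. (1 / measure lebesgue E * (LINT t|lebesgue_on E. v k t powr (- q / p))) powr (1 / q)
        \<le> C / (1 / measure lebesgue E * (LINT t|lebesgue_on E. v k t)) powr (1 / p))" for k
    by (rule scalar_muckenhouptE[OF p q_def v0 _ scal[of k, folded v_def]]) (use S in blast)+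
  then obtain C where C0: "\<And>k. 0 \<le> C k" and loc_v: "\<And>k. locally_integrable D (v k)"
    and loc_v': "\<And>k. locally_integrable D (\<lambda>t. v k t powr (- q / p))"
    and C: "\<And>k E. E \<in> S \<Longrightarrow>
      (1 / measure lebesgue E * (LINT t|lebesgue_on E. v k t powr (- q / p))) powr (1 / q)
        \<le> C k / (1 / measure lebesgue E * (LINT t|lebesgue_on E. v k t)) powr (1 / p)"
    by metis
  have pd: "AE t in lebesgue_on D. posdef (W t)" using W by (simp add: matrix_weight_def)
  have "\<forall>k. \<exists>c. AE t in lebesgue_on D.
      cmod (mat_powr (W t) (2 / p) $ k $ k * mat_powr (W t) (- 2 / p) $ k $ k) \<le> c"
    using Linf by (simp add: Linfty_def)
  from choice[OF this] obtain c where c: "\<And>k. AE t in lebesgue_on D.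
      cmod (mat_powr (W t) (2 / p) $ k $ k * mat_powr (W t) (- 2 / p) $ k $ k) \<le> c k" by auto
  \<comment> \<open>There are finitely many indices, so one bound and one null set serve all
    \<open>k\<close>.\<close>
  define M where "M = Max (range c)"
  have cM: "c k \<le> M" for k unfolding M_def by (intro Max_ge) auto
  then have M: "AE t in lebesgue_on D. \<forall>k.
      cmod (mat_powr (W t) (2 / p) $ k $ k * mat_powr (W t) (- 2 / p) $ k $ k) \<le> M"
    by (intro eventually_all_finite eventually_mono[OF c] order_trans[OF _ cM])
  define K where "K = CARD('n) powr q * M powr (q / 2)"
  have K0: "0 \<le> K" by (simp add: K_def)
  \<comment> \<open>Comparing the exponents 1 and \<open>2 / p\<close>, whose ratio is
    \<open>p / 2\<close>, bounds the norm of \<open>W\<close> by the sum of the scalar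
    weights.\<close>
  have locW: "locally_integrable D W"
  proof (rule locally_integrable_bound[OF D _ loc_v])
    show "W \<in> borel_measurable (lebesgue_on D)" using W by (simp add: matrix_weight_def)
    show "AE t in lebesgue_on D. norm (W t) \<le> CARD('n) ^ 3 * CARD('n) powr (p / 2) * (\<Sum>k\<in>UNIV. v k t)"
      using pd
    proof eventually_elim
      case (elim t)
      then show ?case
        using norm_mat_powr_le[OF elim, of 1 "2 / p"] p by (simp add: mat_powr_one v_def)
    qed
  qed
  \<comment> \<open>Here the exponents are \<open>- q / p\<close> and \<open>- 2 / p\<close>, with
    ratio \<open>q / 2\<close>. The resulting diagonal entries are the squares of the \<beta>'s,
    which are then traded for the dual scalar weights.\<close>
  have locW': "locally_integrable D (\<lambda>t. mat_powr (W t) (- q / p))"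
  proof (rule locally_integrable_bound[OF D borel_measurable_mat_powr[OF D W] loc_v'])
    let ?c = "CARD('n) ^ 3 * CARD('n) powr (q / 2)"
    show "AE t in lebesgue_on D. norm (mat_powr (W t) (- q / p))
        \<le> (?c * M powr (q / 2)) * (\<Sum>k\<in>UNIV. v k t powr (- q / p))"
      using pd M
    proof eventually_elim
      case (elim t)
      have "norm (mat_powr (W t) (- q / p)) \<le> ?c * (\<Sum>k\<in>UNIV. Re (mat_powr (W t) (- 2 / p) $ k $ k) powr (q / 2))"
        using norm_mat_powr_le[OF elim(1), of "- q / p" "- 2 / p"] p q0 by (simp add: field_simps)
      also have "\<dots> \<le> ?c * (\<Sum>k\<in>UNIV. M powr (q / 2) * v k t powr (- q / p))"
      proof (intro mult_left_mono sum_mono)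
        fix k
        have "Re (mat_powr (W t) (- 2 / p) $ k $ k) powr (q / 2) =
            norm (mat_powr (W t) (- (1 / p)) *v axis k 1) powr q"
          using norm_mat_powr_axis[OF elim(1), of "- (1 / p)" k] norm_mat_powr_axis_pos[OF elim(1), of "- (1 / p)" k]
          by (simp add: powr_powr flip: powr_numeral)
        also have "\<dots> \<le> M powr (q / 2) * v k t powr (- q / p)"
          unfolding v_def using elim p q0 by (intro norm_mat_powr_minus_axis_le) auto
        finally show "Re (mat_powr (W t) (- 2 / p) $ k $ k) powr (q / 2) \<le> M powr (q / 2) * v k t powr (- q / p)" .
      qed auto
      finally show ?case by (simp add: sum_distrib_left mult.assoc)
    qed
  qed
  \<comment> \<open>\<open>K\<close> comes from the pointwise estimate, the sum from the scalar
    conditions; the root of order \<open>q\<close> is taken at the end.\<close>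
  define K' where "K' = K * (\<Sum>k\<in>UNIV. C k powr q)"
  have K'0: "0 \<le> K'" using K0 by (auto simp: K'_def intro!: mult_nonneg_nonneg sum_nonneg)
  have main: "averaged_norm q E (\<lambda>t. dual_norm (rho p W t)) x
      \<le> K' powr (1 / q) * dual_norm (averaged_norm p E (rho p W)) x" if E: "E \<in> S" for E x
  proof -
    have EL: "E \<in> sets lebesgue" and Eb: "bounded E" and ED: "E \<subseteq> D" using S[OF E] by auto
    let ?L = "lebesgue_on E" and ?e = "1 / measure lebesgue E"
    let ?d = "dual_norm (averaged_norm p E (rho p W)) x"
    have onE: "AE t in ?L. P t" if "AE t in lebesgue_on D. P t" for P
      using that EL ED D by (auto simp: AE_restrict_space_iff elim!: eventually_mono)
    have int_v': "integrable ?L (\<lambda>t. v k t powr (- q / p))" for k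
      by (rule locally_integrableD[OF loc_v' EL Eb ED])
    define G where "G t = K * (\<Sum>k\<in>UNIV. cmod (x $ k) powr q * v k t powr (- q / p))" for t
    have G0: "0 \<le> G t" for t unfolding G_def using K0 by (intro mult_nonneg_nonneg sum_nonneg) auto
    have int_G: "integrable ?L G" unfolding G_def using int_v' by auto
    have le_G: "AE t in ?L. norm (mat_powr (W t) (- (1 / p)) *v x) powr q \<le> G t"
      using onE[OF pd] onE[OF M]
    proof eventually_elim
      case (elim t)
      then show ?case unfolding G_def K_def v_def
        using p q0 by (intro norm_mat_powr_minus_le) auto
    qed
    \<comment> \<open>Only for a bounded set does the real supremum in \<open>dual_norm\<close>
      dominate its elements, as the test vectors below require.\<close>
    have bdd: "bdd_above ((\<lambda>y. cmod (cinner x y) / averaged_norm p E (rho p W) y) ` {y. y \<noteq> 0})"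
      by (rule bdd_above_dual_averaged_norm[OF p q_def EL onE[OF pd] int_G le_G])
    \<comment> \<open>Almost everywhere \<open>rho p W t (axis k 1) powr p\<close> equals
      \<open>v k t\<close>, so the averaged norm of a basis vector is the quantity in the scalar
      condition.\<close>
    have avg_axis: "averaged_norm p E (rho p W) (axis k 1) = (?e * (LINT t|?L. v k t)) powr (1 / p)" for k
    proof -
      have "(LINT t|?L. rho p W t (axis k 1) powr p) = (LINT t|?L. v k t)"
      proof (rule integral_cong_AE)
        have "(\<lambda>t. mat_powr (W t) (1 / p)) \<in> borel_measurable ?L"
          by (rule measurable_restrict_mono[OF borel_measurable_mat_powr[OF D W] ED])
        moreover have "continuous_on UNIV (\<lambda>A :: complex ^ 'n ^ 'n. norm (A *v axis k 1))"
          unfolding matrix_vector_mult_def by (intro continuous_intros)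
        ultimately have "(\<lambda>t. rho p W t (axis k 1)) \<in> borel_measurable ?L"
          unfolding rho_def by (rule borel_measurable_continuous_on[rotated])
        then show "(\<lambda>t. rho p W t (axis k 1) powr p) \<in> borel_measurable ?L" by measurable
        show "v k \<in> borel_measurable ?L"
          using locally_integrableD[OF loc_v EL Eb ED] by blast
        show "AE t in ?L. rho p W t (axis k 1) powr p = v k t"
          using onE[OF pd]
        proof eventually_elim
          case (elim t)
          then show ?case
            using norm_mat_powr_axis[OF elim, of "1 / p" k] norm_mat_powr_axis_pos[OF elim, of "1 / p" k]
            by (simp add: v_def rho_def powr_powr flip: powr_numeral)
        qed
      qed
      then show ?thesis by (simp add: averaged_norm_lebesgue_on[OF EL])
    qed
    have coord: "cmod (x $ k) / (?e * (LINT t|?L. v k t)) powr (1 / p) \<le> ?d" for k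
      using dual_norm_upper[OF bdd, of "axis k 1"] by (simp add: avg_axis cinner_axis_right)
    have "0 \<le> cmod (x $ undefined) / (?e * (LINT t|?L. v undefined t)) powr (1 / p)" by simp
    then have d0: "0 \<le> ?d" using coord order_trans by blast
    \<comment> \<open>First the scalar condition for \<open>v k\<close>, then the test vector
      \<open>axis k 1\<close>.\<close>
    have avg_v': "cmod (x $ k) powr q * (?e * (LINT t|?L. v k t powr (- q / p))) \<le> C k powr q * ?d powr q" for k
    proof -
      have nn: "0 \<le> ?e * (LINT t|?L. v k t powr (- q / p))"
        by (intro mult_nonneg_nonneg integral_nonneg_AE) auto
      then have "cmod (x $ k) powr q * (?e * (LINT t|?L. v k t powr (- q / p)))
          = (cmod (x $ k) * (?e * (LINT t|?L. v k t powr (- q / p))) powr (1 / q)) powr q"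
        using q0 by (simp add: powr_mult powr_powr)
      also have "\<dots> \<le> (cmod (x $ k) * (C k / (?e * (LINT t|?L. v k t)) powr (1 / p))) powr q"
        using q0 by (intro powr_mono2 mult_left_mono C E) auto
      also have "\<dots> = (C k * (cmod (x $ k) / (?e * (LINT t|?L. v k t)) powr (1 / p))) powr q"
        by (simp add: mult_ac)
      also have "\<dots> \<le> (C k * ?d) powr q"
        using q0 C0 by (intro powr_mono2 mult_left_mono coord) auto
      finally show ?thesis by (simp add: powr_mult)
    qed
    \<comment> \<open>Integrability of the majorant suffices: should the left integrand not be
      integrable, its integral is 0, which \<open>G \<ge> 0\<close> covers.\<close>
    have "(LINT t|?L. dual_norm (rho p W t) x powr q) \<le> (LINT t|?L. G t)"
    proof (rule integral_mono_AE')
      show "AE t in ?L. dual_norm (rho p W t) x powr q \<le> G t"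
        using onE[OF pd] le_G
      proof eventually_elim
        case (elim t)
        have "0 \<le> dual_norm (rho p W t) x"
          by (rule dual_norm_rho_nonneg) (rule elim(1))
        then have "dual_norm (rho p W t) x powr q \<le> norm (mat_powr (W t) (- (1 / p)) *v x) powr q"
          using q0 by (intro powr_mono2 dual_norm_rho_le elim) auto
        with elim show ?case by simp
      qed
    qed (use int_G G0 in auto)
    then have "?e * (LINT t|?L. dual_norm (rho p W t) x powr q) \<le> ?e * (LINT t|?L. G t)"
      by (intro mult_left_mono) auto
    also have "\<dots> = K * (\<Sum>k\<in>UNIV. cmod (x $ k) powr q * (?e * (LINT t|?L. v k t powr (- q / p))))"
      unfolding G_def using int_v' by (simp add: sum_distrib_left mult_ac)
    also have "\<dots> \<le> K * (\<Sum>k\<in>UNIV. C k powr q * ?d powr q)"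
      by (intro mult_left_mono sum_mono avg_v' K0)
    also have "\<dots> = K' * ?d powr q" by (simp add: K'_def sum_distrib_right)
    finally have "averaged_norm q E (\<lambda>t. dual_norm (rho p W t)) x \<le> (K' * ?d powr q) powr (1 / q)"
      unfolding averaged_norm_lebesgue_on[OF EL] using q0
      by (intro powr_mono2 mult_nonneg_nonneg integral_nonneg_AE) auto
    also have "\<dots> = K' powr (1 / q) * ?d"
      using q0 d0 by (simp add: powr_mult powr_powr)
    finally show ?thesis .
  qed
  show ?thesis
    unfolding muckenhoupt_Ap_def Let_def q_def[symmetric]
    using W locW locW' main by auto
qed

subsection \<open>Balls and products of balls\<close>

lemma euclidean_balls_borel:
  "E \<in> euclidean_balls \<Longrightarrow> E \<in> sets borel \<and> bounded E \<and> E \<subseteq> UNIV"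
  by (auto simp: euclidean_balls_def)

lemma torus_borel: "torus \<in> sets borel"
proof -
  have "torus = (\<Inter>i. {x :: real ^ 'd. 0 \<le> x $ i} \<inter> {x. x $ i < 1})"
    by (auto simp: torus_def)
  also have "\<dots> \<in> sets borel"
    by (intro sets.finite_INT sets.Int borel_closed borel_open closed_Collect_le open_Collect_less
        continuous_intros) auto
  finally show ?thesis .
qed

lemma bounded_torus: "bounded torus"
proof (rule bounded_subset)
  show "bounded (cbox 0 (\<chi> i. 1) :: (real ^ 'd) set)" by (rule bounded_cbox)
  show "torus \<subseteq> (cbox 0 (\<chi> i. 1) :: (real ^ 'd) set)"
    by (auto simp: torus_def mem_box_cart less_imp_le)
qed

text \<open>An infimum is strictly below \<open>r\<close> exactly when some element is; a torus ball
  thereby becomes a union over lattice translates.\<close>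

lemma torus_dist_less_iff:
  "torus_dist x y < r \<longleftrightarrow> (\<exists>n. (\<forall>i. n $ i \<in> \<int>) \<and> dist x (y + n) < r)"
proof -
  have "y \<in> {z. \<forall>i. z $ i - y $ i \<in> \<int>}" by simp
  then have "{z. \<forall>i. z $ i - y $ i \<in> \<int>} \<noteq> {}" by blast
  then have "torus_dist x y < r \<longleftrightarrow> (\<exists>z. (\<forall>i. z $ i - y $ i \<in> \<int>) \<and> dist x z < r)"
    unfolding torus_dist_def by (subst cINF_less_iff) (auto intro: bdd_belowI2[of _ 0])
  also have "\<dots> \<longleftrightarrow> (\<exists>n. (\<forall>i. n $ i \<in> \<int>) \<and> dist x (y + n) < r)"
  proof safe
    fix z assume "\<forall>i. z $ i - y $ i \<in> \<int>" "dist x z < r"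
    then show "\<exists>n. (\<forall>i. n $ i \<in> \<int>) \<and> dist x (y + n) < r"
      by (intro exI[of _ "z - y"]) auto
  next
    fix n assume "\<forall>i. n $ i \<in> \<int>" "dist x (y + n) < r"
    then show "\<exists>z. (\<forall>i. z $ i - y $ i \<in> \<int>) \<and> dist x z < r"
      by (intro exI[of _ "y + n"]) auto
  qed
  finally show ?thesis .
qed

lemma torus_balls_borel:
  assumes "E \<in> torus_balls"
  shows "E \<in> sets borel \<and> bounded E \<and> E \<subseteq> torus"
proof -
  obtain x r where E: "E = {y \<in> torus. torus_dist x y < r}"
    using assms by (auto simp: torus_balls_def)
  \<comment> \<open>A torus ball is the part in the fundamental domain of an open union of
    translated Euclidean balls.\<close>
  have "E = torus \<inter> (\<Union>n\<in>{n. \<forall>i. n $ i \<in> \<int>}. {y. dist x (y + n) < r})"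
    by (auto simp: E torus_dist_less_iff)
  moreover have "open (\<Union>n\<in>{n. \<forall>i. n $ i \<in> \<int>}. {y. dist x (y + n) < r})"
    by (intro open_UN ballI open_Collect_less continuous_intros)
  ultimately have "E \<in> sets borel" using torus_borel by auto
  moreover have "E \<subseteq> torus" by (auto simp: E)
  ultimately show ?thesis using bounded_torus bounded_subset by blast
qed

lemma product_sets_borel:
  fixes S :: "'a::euclidean_space set set" and T :: "'b::euclidean_space set set"
  assumes S: "\<And>E. E \<in> S \<Longrightarrow> E \<in> sets borel \<and> bounded E \<and> E \<subseteq> D"
    and T: "\<And>E. E \<in> T \<Longrightarrow> E \<in> sets borel \<and> bounded E \<and> E \<subseteq> D'"
    and E: "E \<in> product_sets S T"
  shows "E \<in> sets borel \<and> bounded E \<and> E \<subseteq> D \<times> D'"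
proof -
  obtain B B' where "E = B \<times> B'" "B \<in> S" "B' \<in> T"
    using E by (auto simp: product_sets_def)
  with S[of B] T[of B'] show ?thesis
    by (auto simp: borel_Times bounded_Times)
qed

text \<open>Borel sets are preserved by products, which settles the product domains; the chain of
  implications matches the goals of the final statement.\<close>

lemma muckenhoupt_Ap_if_diagonal_borel:
  fixes W :: "'a::euclidean_space \<Rightarrow> complex ^ 'n ^ 'n"
  assumes "1 < p" "D \<in> sets borel"
    and "\<And>E. E \<in> S \<Longrightarrow> E \<in> sets borel \<and> bounded E \<and> E \<subseteq> D"
  shows "matrix_weight D W \<longrightarrow>
    (\<forall>k. (\<lambda>t. mat_powr (W t) (2 / p) $ k $ k * mat_powr (W t) (- 2 / p) $ k $ k) \<in> Linfty D) \<longrightarrow>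
    (\<forall>k. (\<lambda>t. scalar_matrix (Re (mat_powr (W t) (2 / p) $ k $ k) powr (p / 2)))
      \<in> muckenhoupt_Ap p D S) \<longrightarrow>
    W \<in> muckenhoupt_Ap p D S"
proof (intro impI)
  have D: "D \<in> sets lebesgue" using assms(2) by auto
  have S: "E \<in> sets lebesgue \<and> bounded E \<and> E \<subseteq> D" if "E \<in> S" for E
    using assms(3)[OF that] by auto
  assume W: "matrix_weight D W"
    and L: "\<forall>k. (\<lambda>t. mat_powr (W t) (2 / p) $ k $ k * mat_powr (W t) (- 2 / p) $ k $ k) \<in> Linfty D"
    and A: "\<forall>k. (\<lambda>t. scalar_matrix (Re (mat_powr (W t) (2 / p) $ k $ k) powr (p / 2)))
      \<in> muckenhoupt_Ap p D S"
  show "W \<in> muckenhoupt_Ap p D S"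
    by (rule muckenhoupt_Ap_if_diagonal[OF assms(1) D S W L[rule_format] A[rule_format]])
qed

theorem theorem4p3:
  fixes p :: real
  assumes "1 < p"
  shows "(\<forall>(D, S) \<in> {(UNIV, euclidean_balls), (torus, torus_balls)}.
            \<forall>W :: real ^ 'd \<Rightarrow> complex ^ 'N ^ 'N.
              matrix_weight D W \<longrightarrow>
              (\<forall>k. (\<lambda>t. mat_powr (W t) (2 / p) $ k $ k * mat_powr (W t) (- 2 / p) $ k $ k)
                     \<in> Linfty D) \<longrightarrow>
              (\<forall>k. (\<lambda>t. scalar_matrix (Re (mat_powr (W t) (2 / p) $ k $ k) powr (p / 2)))
                     \<in> muckenhoupt_Ap p D S) \<longrightarrow>
              W \<in> muckenhoupt_Ap p D S)
       \<and> (\<forall>(D, S) \<in> {(UNIV, product_sets euclidean_balls euclidean_balls),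
                      (torus \<times> torus, product_sets torus_balls torus_balls)}.
            \<forall>W :: (real ^ 'm) \<times> (real ^ 'n) \<Rightarrow> complex ^ 'N ^ 'N.
              matrix_weight D W \<longrightarrow>
              (\<forall>k. (\<lambda>t. mat_powr (W t) (2 / p) $ k $ k * mat_powr (W t) (- 2 / p) $ k $ k)
                     \<in> Linfty D) \<longrightarrow>
              (\<forall>k. (\<lambda>t. scalar_matrix (Re (mat_powr (W t) (2 / p) $ k $ k) powr (p / 2)))
                     \<in> muckenhoupt_Ap p D S) \<longrightarrow>
              W \<in> muckenhoupt_Ap p D S)"
proof (intro conjI)
  note ap = muckenhoupt_Ap_if_diagonal_borel[OF assms]
  note euclidean = ap[OF borel_open[OF open_UNIV] euclidean_balls_borel]
  note torus = ap[OF torus_borel torus_balls_borel]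
  show "\<forall>(D, S) \<in> {(UNIV, euclidean_balls), (torus, torus_balls)}.
            \<forall>W :: real ^ 'd \<Rightarrow> complex ^ 'N ^ 'N.
              matrix_weight D W \<longrightarrow>
              (\<forall>k. (\<lambda>t. mat_powr (W t) (2 / p) $ k $ k * mat_powr (W t) (- 2 / p) $ k $ k)
                     \<in> Linfty D) \<longrightarrow>
              (\<forall>k. (\<lambda>t. scalar_matrix (Re (mat_powr (W t) (2 / p) $ k $ k) powr (p / 2)))
                     \<in> muckenhoupt_Ap p D S) \<longrightarrow>
              W \<in> muckenhoupt_Ap p D S"
    unfolding ball_simps prod.case
    by (intro conjI allI TrueI euclidean torus)
  have UNIV: "E \<in> sets borel \<and> bounded E \<and> E \<subseteq> UNIV"
    if "E \<in> product_sets euclidean_balls euclidean_balls" for E :: "((real ^ 'm) \<times> (real ^ 'n)) set"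
    using product_sets_borel[OF euclidean_balls_borel euclidean_balls_borel that] by simp
  note euclidean_product = ap[OF borel_open[OF open_UNIV] UNIV]
  note torus_product = ap[OF borel_Times[OF torus_borel torus_borel]
      product_sets_borel[OF torus_balls_borel torus_balls_borel]]
  show "\<forall>(D, S) \<in> {(UNIV, product_sets euclidean_balls euclidean_balls),
                      (torus \<times> torus, product_sets torus_balls torus_balls)}.
            \<forall>W :: (real ^ 'm) \<times> (real ^ 'n) \<Rightarrow> complex ^ 'N ^ 'N.
              matrix_weight D W \<longrightarrow>
              (\<forall>k. (\<lambda>t. mat_powr (W t) (2 / p) $ k $ k * mat_powr (W t) (- 2 / p) $ k $ k)
                     \<in> Linfty D) \<longrightarrow>
              (\<forall>k. (\<lambda>t. scalar_matrix (Re (mat_powr (W t) (2 / p) $ k $ k) powr (p / 2)))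
                     \<in> muckenhoupt_Ap p D S) \<longrightarrow>
              W \<in> muckenhoupt_Ap p D S"
    unfolding ball_simps prod.case
    by (intro conjI allI TrueI euclidean_product torus_product)
qed

end
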